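(* Let $G$ be a connected graph of bounded degree. If $G$ has finite separation, i.e. $n\mapsto sep_G(n)$ is a bounded function, then there is a regular map from $G$ to the $3$-regular tree.
   Context: Graphs are regarded as metric spaces on their vertex sets, with the graph distance. Separation: for a finite set $S$ of vertices of a graph $G$, $cut(S)$ is the minimum size of a subset $C_S\subset S$ such that the largest connected component of the subgraph of $G$ induced by $S\setminus C_S$ has fewer than $|S|/2$ vertices. For a positive integer $n$, $sep_G(n)=\sup\{cut(S): S\subset V(G),\ |S|=n\}$ (supremum of the empty set being $0$). Regular maps: let $(X,d_X),(Y,d_Y)$ be metric spaces and $\kappa<\infty$. A (not necessarily continuous) map $f:X\to Y$ is $\kappa$-regular if (1) $d_Y(f(x_0),f(x_1))\le \kappa(1+d_X(x_0,x_1))$ for every $x_0,x_1\in X$, and (2) for every open ball $B=B(y_0,1)$ of radius $1$ in $Y$, the inverse image $f^{-1}(B)$ can be covered by $\kappa$ open balls of radius $1$ in $X$. A map is regular if it is $\kappa$-regular for some finite $\kappa$. (For graphs, open balls of radius 1 are single vertices, so (2) says that each vertex of $Y$ has at most $\kappa$ preimages.) *)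

theory Defs
  imports "HOL-Analysis.Abstract_Metric_Spaces" "Graph_Theory.Graph_Theory"
begin

text \<open>
  A simple undirected graph, possibly infinite, is a symmetric loop-free digraph without
  parallel arcs (locale \<^locale>\<open>pair_bidirected_digraph\<close>): the undirected edge uv is the pair of
  arcs (u,v) and (v,u). So the degree of a vertex is its out-degree, and strongly connected
  components are connected components.
\<close>

definition bounded_degree :: "'a pair_pre_digraph \<Rightarrow> bool" where
  "bounded_degree G \<longleftrightarrow>
     (\<exists>D. \<forall>v \<in> pverts G. finite (out_arcs G v) \<and> out_degree G v \<le> D)"

text \<open>
  The predicate \<^const>\<open>tree\<close> of the library is about directed trees: it counts u,v,u as a cycle,
  so it fails for every symmetric digraph with an edge. In an undirected simple graph the cycles
  are those of length at least 3.
\<close>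

definition undirected_tree :: "'a pair_pre_digraph \<Rightarrow> bool" where
  "undirected_tree G \<longleftrightarrow> pair_bidirected_digraph G \<and> Digraph_Component.connected G \<and>
     \<not> (\<exists>p. pre_digraph.cycle G p \<and> 3 \<le> length p)"

definition regular_tree :: "nat \<Rightarrow> 'a pair_pre_digraph \<Rightarrow> bool" where
  "regular_tree k T \<longleftrightarrow> undirected_tree T \<and>
     (\<forall>v \<in> pverts T. finite (out_arcs T v) \<and> out_degree T v = k)"

definition graph_dist :: "'a pair_pre_digraph \<Rightarrow> 'a \<Rightarrow> 'a \<Rightarrow> real" where
  "graph_dist G u v = real_of_ereal (wf_digraph.\<mu> G (\<lambda>_. 1) u v)"


definition largest_component :: "'a pair_pre_digraph \<Rightarrow> 'a set \<Rightarrow> nat" where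
  "largest_component G S = Sup (card ` pre_digraph.sccs_verts (with_proj G \<restriction> S))"

definition cut :: "'a pair_pre_digraph \<Rightarrow> 'a set \<Rightarrow> nat" where
  "cut G S =
     (LEAST k. \<exists>C \<subseteq> S. card C = k \<and> real (largest_component G (S - C)) < real (card S) / 2)"

text \<open>
  On \<^typ>\<open>nat\<close>, \<^term>\<open>Sup {} = (0::nat)\<close>, and the supremum below is a true supremum, since
  \<^term>\<open>cut G S \<le> card S\<close> for finite non-empty \<^term>\<open>S\<close>.
\<close>

lemma cut_le_card:
  assumes "finite S" "S \<noteq> {}"
  shows "cut G S \<le> card S"
proof -
  have "\<not> u \<rightarrow>\<^sup>*\<^bsub>with_proj G \<restriction> {}\<^esub> v" for u v
    by (auto elim: reachable_in_vertsE)
  then have "pre_digraph.sccs_verts (with_proj G \<restriction> {}) = {}"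
    unfolding pre_digraph.sccs_verts_def by blast
  then have "largest_component G (S - S) = 0"
    by (simp add: largest_component_def)
  then show ?thesis
    using assms unfolding cut_def by (intro Least_le exI[of _ S]) (simp add: card_gt_0_iff)
qed

definition sep :: "'a pair_pre_digraph \<Rightarrow> nat \<Rightarrow> nat" where
  "sep G n = Sup {cut G S | S. S \<subseteq> pverts G \<and> finite S \<and> card S = n}"

definition finite_separation :: "'a pair_pre_digraph \<Rightarrow> bool" where
  "finite_separation G \<longleftrightarrow> (\<exists>B. \<forall>n \<ge> 1. sep G n \<le> B)"


definition kappa_regular ::
  "real \<Rightarrow> 'a set \<Rightarrow> ('a \<Rightarrow> 'a \<Rightarrow> real) \<Rightarrow> 'b set \<Rightarrow> ('b \<Rightarrow> 'b \<Rightarrow> real) \<Rightarrow> ('a \<Rightarrow> 'b) \<Rightarrow> bool" where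
  "kappa_regular \<kappa> X dX Y dY f \<longleftrightarrow>
     f \<in> X \<rightarrow> Y \<and>
     (\<forall>x0 \<in> X. \<forall>x1 \<in> X. dY (f x0) (f x1) \<le> \<kappa> * (1 + dX x0 x1)) \<and>
     (\<forall>y0 \<in> Y. \<exists>A \<subseteq> X. finite A \<and> real (card A) \<le> \<kappa> \<and>
        {x \<in> X. f x \<in> Metric_space.mball Y dY y0 1} \<subseteq> (\<Union>a \<in> A. Metric_space.mball X dX a 1))"

definition regular_map ::
  "'a set \<Rightarrow> ('a \<Rightarrow> 'a \<Rightarrow> real) \<Rightarrow> 'b set \<Rightarrow> ('b \<Rightarrow> 'b \<Rightarrow> real) \<Rightarrow> ('a \<Rightarrow> 'b) \<Rightarrow> bool" where
  "regular_map X dX Y dY f \<longleftrightarrow> (\<exists>\<kappa>. kappa_regular \<kappa> X dX Y dY f)"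


lemma graph_dist_eq:
  assumes "pair_bidirected_digraph G" "Digraph_Component.connected G"
    and "u \<in> pverts G" "v \<in> pverts G"
  shows "\<exists>p. pre_digraph.awalk G u p v \<and> graph_dist G u v = real (length p) \<and>
           (\<forall>q. pre_digraph.awalk G u q v \<longrightarrow> length p \<le> length q)"
proof -
  interpret pair_bidirected_digraph G by fact
  have cost: "awalk_cost (\<lambda>_. 1) p = real (length p)" for p :: "('a \<times> 'a) list"
    by (induction p) auto
  have "mk_symmetric G = G"
    using arcs_symmetric by (cases G) (force simp: mk_symmetric_def)
  then have "strongly_connected G"
    using assms(2) by (simp add: connected_def)
  then have "u \<rightarrow>\<^sup>*\<^bsub>G\<^esub> v"
    using assms(3,4) by (auto simp: strongly_connected_def)
  then obtain p0 where "awalk u p0 v"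
    using reachable_awalk by blast
  then obtain p where p: "awalk u p v" "\<And>q. awalk u q v \<Longrightarrow> length p \<le> length q"
    using ex_has_least_nat[of "\<lambda>p. awalk u p v" p0 length] by blast
  have "\<mu> (\<lambda>_. 1) u v = ereal (real (length p))"
    unfolding \<mu>_def cost using p by (intro antisym INF_greatest INF_lower2[of p]) auto
  then show ?thesis
    using p by (auto simp: graph_dist_def)
qed

lemma Metric_space_graph_dist:
  assumes "pair_bidirected_digraph G" "Digraph_Component.connected G"
  shows "Metric_space (pverts G) (graph_dist G)"
proof
  interpret pair_bidirected_digraph G by fact
  note ex = graph_dist_eq[OF assms]
  have nonneg: "0 \<le> graph_dist G u v" for u v
    unfolding graph_dist_def \<mu>_def
    by (intro real_of_ereal_pos INF_greatest) (auto intro!: pos_cost_pos_awalk_cost)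
  show "0 \<le> graph_dist G u v" for u v by (rule nonneg)
  have le: "graph_dist G u v \<le> graph_dist G v u" if uv: "u \<in> pverts G" "v \<in> pverts G" for u v
  proof -
    obtain p where p: "awalk v p u" "graph_dist G v u = real (length p)"
      using ex[OF uv(2,1)] by auto
    have len: "length (rev_path q) = length q" for q :: "('a \<times> 'a) list"
      by (induction q) auto
    have "awalk u (rev_path p) v" using p(1) by simp
    moreover obtain q where q: "awalk u q v" "graph_dist G u v = real (length q)"
      "\<And>r. awalk u r v \<Longrightarrow> length q \<le> length r"
      using ex[OF uv] by blast
    ultimately have "length q \<le> length p" using len[of p] by metis
    then show ?thesis using p(2) q(2) by simp
  qed
  have sym_in: "graph_dist G u v = graph_dist G v u" if "u \<in> pverts G" "v \<in> pverts G" for u v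
    using le[OF that] le[OF that(2,1)] by simp
  show "graph_dist G u v = graph_dist G v u" for u v
  proof (cases "u \<in> pverts G \<and> v \<in> pverts G")
    case False
    then have "\<not> u \<rightarrow>\<^sup>*\<^bsub>G\<^esub> v" "\<not> v \<rightarrow>\<^sup>*\<^bsub>G\<^esub> u"
      using reachable_in_verts by auto
    then show ?thesis by (simp add: graph_dist_def shortest_path_inf)
  qed (use sym_in in auto)
  show "graph_dist G u v = 0 \<longleftrightarrow> u = v" if uv: "u \<in> pverts G" "v \<in> pverts G" for u v
  proof -
    obtain p where p: "awalk u p v" "graph_dist G u v = real (length p)"
      "\<And>q. awalk u q v \<Longrightarrow> length p \<le> length q"
      using ex[OF uv] by blast
    show ?thesis
    proof
      assume "graph_dist G u v = 0"
      then show "u = v" using p by (simp add: awalk_Nil_iff)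
    next
      assume "u = v"
      then have "awalk u [] v" using uv by (simp add: awalk_Nil_iff)
      then have "length p \<le> length ([] :: ('a \<times> 'a) list)" by (rule p(3))
      then show "graph_dist G u v = 0" using p(2) by simp
    qed
  qed
  show "graph_dist G u w \<le> graph_dist G u v + graph_dist G v w"
    if uvw: "u \<in> pverts G" "v \<in> pverts G" "w \<in> pverts G" for u v w
  proof -
    obtain p where p: "awalk u p v" "graph_dist G u v = real (length p)"
      using ex[OF uvw(1,2)] by auto
    obtain q where q: "awalk v q w" "graph_dist G v w = real (length q)"
      using ex[OF uvw(2,3)] by auto
    have "awalk u (p @ q) w" using p(1) q(1) by (rule awalk_appendI)
    moreover obtain r where r: "awalk u r w" "graph_dist G u w = real (length r)"
      "\<And>s. awalk u s w \<Longrightarrow> length r \<le> length s"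
      using ex[OF uvw(1,3)] by blast
    ultimately have "length r \<le> length (p @ q)" by blast
    then show ?thesis using p(2) q(2) r(2) by simp
  qed
qed

end

(*
The heart of the matter is that bounded separation forces separators of bounded size that halve an
arbitrary finite set W of vertices, not only the whole set S. If this fails in some S, then every
small X leaves exactly one component b(X) of S - X containing more than half of W. Fix a suitable
integer w and let C minimise w |X| + |b(X)|. Minimality says that no few vertices can cut off much
of b(C) from the inside, and, by max-flow min-cut, that w |C| units can flow from the outside of
b(C) into C when every vertex is a source of one unit and has capacity w. The union of b(C) with
the support of a minimal such flow has at most w |C| + |b(C)| vertices, and no set of few vertices
can separate it.

Given such separators, G is cut recursively: from a set S with a set R of at most K boundary vertices
one removes a bag X containing R such that every component of S - X again has at most K vertices
next to X. The bags form a tree of bounded degree, and adjacent vertices lie in the same bag or in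
adjacent bags. Every vertex is reached after finitely many steps because its distance to the
boundary set decreases. The tree of bags embeds in the binary tree, hence in the 3-regular tree.
*)

theory Submission
  imports Defs
begin

section \<open>Connected components of induced subgraphs\<close>

definition component :: "'a rel \<Rightarrow> 'a set \<Rightarrow> 'a \<Rightarrow> 'a set" where
  "component E S x = {y. (x, y) \<in> (E \<inter> S \<times> S)\<^sup>*}"

lemma component_refl [simp]: "x \<in> component E S x"
  by (simp add: component_def)

lemma component_subset: "x \<in> S \<Longrightarrow> component E S x \<subseteq> S"
  by (auto simp: component_def elim: rtranclE)

lemma component_closed:
  "\<lbrakk>y \<in> component E S x; (y, z) \<in> E; y \<in> S; z \<in> S\<rbrakk> \<Longrightarrow> z \<in> component E S x"
  unfolding component_def by (auto intro: rtrancl_into_rtrancl)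

text \<open>Path induction in set form. In the haven argument, components after deleting a separator
  are bounded by choosing a suitable invariant set \<open>K\<close>.\<close>

lemma component_least:
  assumes "x \<in> K" "\<And>y z. \<lbrakk>y \<in> K; y \<in> S; z \<in> S; (y, z) \<in> E\<rbrakk> \<Longrightarrow> z \<in> K"
  shows "component E S x \<subseteq> K"
proof
  fix y assume "y \<in> component E S x"
  then have "(x, y) \<in> (E \<inter> S \<times> S)\<^sup>*" by (simp add: component_def)
  then show "y \<in> K" by (induction rule: rtrancl_induct) (use assms in auto)
qed

lemma component_mono: "S \<subseteq> S' \<Longrightarrow> component E S x \<subseteq> component E S' x"
  unfolding component_def by (auto intro: rtrancl_mono[THEN subsetD, rotated])

lemma component_eq:
  assumes "sym E" "y \<in> component E S x"
  shows "component E S y = component E S x"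
proof -
  have "sym ((E \<inter> S \<times> S)\<^sup>*)"
    using assms(1) by (intro sym_rtrancl) (auto simp: sym_def)
  then have "(y, x) \<in> (E \<inter> S \<times> S)\<^sup>*" "(x, y) \<in> (E \<inter> S \<times> S)\<^sup>*"
    using assms(2) by (auto simp: component_def dest: symD)
  then show ?thesis by (auto simp: component_def)
qed

text \<open>A path in \<open>S'\<close> from \<open>x\<close> never leaves the component of
  \<open>x\<close> in the larger \<open>S\<close>, so all its vertices lie in \<open>T\<close>. This
  localises components after a separator has been placed inside one piece.\<close>

lemma component_transfer:
  assumes "x \<in> S'" "S' \<subseteq> S" "component E S x \<inter> S' \<subseteq> T"
  shows "component E S' x \<subseteq> component E T x"
proof -
  have "component E S' x \<subseteq> component E T x \<inter> component E S x"
  proof (rule component_least)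
    fix y z
    assume y: "y \<in> component E T x \<inter> component E S x" "y \<in> S'" and z: "z \<in> S'" "(y, z) \<in> E"
    then have "z \<in> component E S x"
      using component_closed[of y E S x z] assms(2) by auto
    moreover have "z \<in> component E T x"
      using component_closed[of y E T x z] y z assms(3) \<open>z \<in> component E S x\<close> by auto
    ultimately show "z \<in> component E T x \<inter> component E S x" by simp
  qed simp
  then show ?thesis by simp
qed

text \<open>A path has finitely many vertices. This reduces connectivity in an infinite set to
  connectivity in finite ones.\<close>

lemma component_finitary:
  assumes "y \<in> component E S x" "x \<in> S"
  obtains F where "finite F" "F \<subseteq> S" "y \<in> component E F x"
proof -
  have "(x, y) \<in> (E \<inter> S \<times> S)\<^sup>*" using assms(1) by (simp add: component_def)
  then have "\<exists>F. finite F \<and> F \<subseteq> S \<and> y \<in> F \<and> y \<in> component E F x"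
  proof (induction rule: rtrancl_induct)
    case base
    show ?case using assms(2) by (intro exI[of _ "{x}"]) simp
  next
    case (step y z)
    then obtain F where F: "finite F" "F \<subseteq> S" "y \<in> F" "y \<in> component E F x" by blast
    then have "y \<in> component E (insert z F) x"
      using component_mono[of F "insert z F" E x] by auto
    then have "z \<in> component E (insert z F) x"
      using step.hyps F by (auto intro: component_closed)
    then show ?case using F step.hyps by (intro exI[of _ "insert z F"]) auto
  qed
  then show ?thesis using that by blast
qed

section \<open>Balanced separators of arbitrary vertex weights\<close>

text \<open>Inclusion-exclusion turns both sides into sums over a union and an intersection. The
  result is the submodularity of boundary capacity, which makes tight cuts closed under
  union.\<close>

lemma sum_uncross:
  fixes f :: "'a \<Rightarrow> nat"
  assumes "finite A" "finite B" "A' \<union> B' \<subseteq> A \<union> B" "A' \<inter> B' \<subseteq> A \<inter> B"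
  shows "sum f A' + sum f B' \<le> sum f A + sum f B"
proof -
  have fin: "finite A'" "finite B'"
    using assms(1-3) by (auto intro: finite_subset[of _ "A \<union> B"])
  have "sum f A' + sum f B' = sum f (A' \<union> B') + sum f (A' \<inter> B')"
    using fin by (rule sum.union_inter[symmetric])
  also have "\<dots> \<le> sum f (A \<union> B) + sum f (A \<inter> B)"
    using assms by (intro add_mono sum_mono2) auto
  also have "\<dots> = sum f A + sum f B"
    using assms(1,2) by (rule sum.union_inter)
  finally show ?thesis .
qed

text \<open>
  The cut condition says that \<open>w * card C\<close> units can flow into \<open>C\<close> when every vertex of \<open>A\<close> is a
  source of one unit and has capacity \<open>w\<close>; \<open>P\<close> is the support of such a flow. Instead of constructing
  a flow, the vertex capacities are decreased as long as the cut condition permits. Then every vertex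
  of positive capacity lies in the largest tight set or on its boundary, and tightness bounds their
  number.
\<close>

lemma small_conducting_subset:
  fixes E :: "'a rel" and w :: nat
  assumes fin: "finite A" and CA: "C \<subseteq> A" and w: "0 < w"
    and cond: "\<And>U. U \<subseteq> A \<Longrightarrow> w * card C \<le> w * card ((C \<union> E `` U) \<inter> A - U) + card U"
  obtains P where "C \<subseteq> P" "P \<subseteq> A" "card P \<le> w * card C"
    "\<And>U. U \<subseteq> P \<Longrightarrow> w * card C \<le> w * card ((C \<union> E `` U) \<inter> P - U) + card U"
proof -
  define bd where "bd U = (C \<union> E `` U) \<inter> A - U" for U
  define sp where "sp cap U = {u\<in>U. 0 < cap u}" for cap :: "'a \<Rightarrow> nat" and U
  \<comment> \<open>\<open>h cap U\<close> is the cut value bounding the flow into \<open>C\<close>: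
    what enters through the boundary \<open>bd U\<close> plus one unit from each source inside
    \<open>U\<close>, where vertices without capacity emit nothing.\<close>
  define h where "h cap U = sum cap (bd U) + card (sp cap U)" for cap U
  define good where "good cap \<longleftrightarrow> (\<forall>v. cap v \<le> w) \<and> (\<forall>U\<subseteq>A. w * card C \<le> h cap U)" for cap
  have finbd: "finite (bd U)" for U
    using fin by (auto simp: bd_def)
  have "good (\<lambda>_. w)"
    using cond w by (simp add: good_def h_def sp_def bd_def mult.commute)
  \<comment> \<open>Minimal total capacity replaces minimality of a flow: lowering any positive
    capacity by one must violate some cut.\<close>
  then obtain cap where cap: "good cap" and least: "\<And>c. good c \<Longrightarrow> sum cap A \<le> sum c A"
    using ex_has_least_nat[of good "\<lambda>_. w" "\<lambda>c. sum c A"] by blast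
  have capw: "cap v \<le> w" for v
    using cap by (simp add: good_def)
  define tight where "tight U \<longleftrightarrow> U \<subseteq> A \<and> h cap U = w * card C" for U
  \<comment> \<open>Since \<open>bd {} = C\<close> and no capacity exceeds \<open>w\<close>, the
    empty cut has no slack. Hence a tight set of maximal size exists.\<close>
  have "w * card C \<le> sum cap C"
    using cap CA by (force simp: good_def h_def bd_def sp_def Int_absorb2)
  moreover have "sum cap C \<le> w * card C"
    using sum_bounded_above[of C cap w] capw by (simp add: mult.commute)
  ultimately have "tight {}"
    using CA by (simp add: tight_def h_def bd_def sp_def Int_absorb2)
  moreover have "\<forall>U. tight U \<longrightarrow> card U < Suc (card A)"
    using fin by (auto simp: tight_def less_Suc_eq_le intro: card_mono)
  ultimately obtain M where M: "tight M" and Mmax: "\<And>U. tight U \<Longrightarrow> card U \<le> card M"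
    using ex_has_greatest_nat[of tight "{}" card "Suc (card A)"] by metis
  have finM: "finite U" if "tight U" for U
    using that fin finite_subset by (auto simp: tight_def)
  \<comment> \<open>Uncrossing makes the union of two tight sets tight, so the tight set of maximal
    size contains all the others.\<close>
  have tightM: "U \<subseteq> M" if U: "tight U" for U
  proof -
    have "sum cap (bd (U \<union> M)) + sum cap (bd (U \<inter> M)) \<le> sum cap (bd U) + sum cap (bd M)"
      by (intro sum_uncross finbd) (auto simp: bd_def)
    moreover have "card (sp cap (U \<union> M)) + card (sp cap (U \<inter> M)) = card (sp cap U) + card (sp cap M)"
    proof -
      have "sp cap (U \<union> M) = sp cap U \<union> sp cap M" "sp cap (U \<inter> M) = sp cap U \<inter> sp cap M"
        "finite (sp cap U)" "finite (sp cap M)"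
        using finM[OF U] finM[OF M] by (auto simp: sp_def)
      then show ?thesis
        using card_Un_Int[of "sp cap U" "sp cap M"] by simp
    qed
    ultimately have "h cap (U \<union> M) + h cap (U \<inter> M) \<le> h cap U + h cap M"
      by (simp add: h_def)
    moreover have "w * card C \<le> h cap W" if "W \<subseteq> U \<union> M" for W
    proof -
      have "W \<subseteq> A" using U M that by (auto simp: tight_def)
      then show ?thesis using cap by (simp add: good_def)
    qed
    then have "w * card C \<le> h cap (U \<union> M)" "w * card C \<le> h cap (U \<inter> M)"
      by auto
    ultimately have "tight (U \<union> M)"
      using U M by (auto simp: tight_def)
    then have "card (U \<union> M) \<le> card M" by (rule Mmax)
    then show ?thesis
      using card_seteq[of "U \<union> M" M] finM U M by auto
  qed
  define P where "P = sp cap A"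
  \<comment> \<open>Lowering \<open>cap u\<close> by one breaks some cut \<open>U\<close>. As
    \<open>h\<close> drops by at most one, \<open>U\<close> was tight, and \<open>u\<close> lies in
    it or on its boundary. Since \<open>U \<subseteq> M\<close>, the same holds for
    \<open>M\<close>.\<close>
  have PM: "P \<subseteq> sp cap M \<union> (bd M \<inter> P)"
  proof
    fix u assume uP: "u \<in> P"
    then have uA: "u \<in> A" and cu: "0 < cap u" by (auto simp: P_def sp_def)
    define c where "c = cap(u := cap u - 1)"
    have "sum c A < sum cap A"
      using fin uA cu by (intro sum_strict_mono_ex1) (auto simp: c_def)
    then have "\<not> good c" using least[of c] by auto
    moreover have "c v \<le> w" for v using capw[of v] capw[of u] by (auto simp: c_def)
    ultimately obtain U where U: "U \<subseteq> A" "h c U < w * card C"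
      by (auto simp: good_def not_le)
    have hU: "w * card C \<le> h cap U" using cap U(1) by (auto simp: good_def)
    have finU: "finite U" using U(1) fin finite_subset by blast
    have "tight U \<and> u \<in> U \<union> bd U"
    proof (cases "u \<in> U")
      case True
      then have "sum c (bd U) = sum cap (bd U)"
        by (intro sum.cong) (auto simp: c_def bd_def)
      moreover have "card (sp cap U) \<le> Suc (card (sp c U))"
      proof -
        have "sp cap U \<subseteq> insert u (sp c U)" by (auto simp: sp_def c_def)
        then have "card (sp cap U) \<le> card (insert u (sp c U))"
          using finU by (intro card_mono) (auto simp: sp_def)
        also have "\<dots> \<le> Suc (card (sp c U))"
          by (rule card_insert_le_m1) auto
        finally show ?thesis .
      qed
      ultimately show ?thesis
        using U hU True by (auto simp: h_def tight_def)
    next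
      case False
      have sp: "sp c U = sp cap U" using False by (auto simp: sp_def c_def)
      have "u \<in> bd U"
      proof (rule ccontr)
        assume "u \<notin> bd U"
        then have "sum c (bd U) = sum cap (bd U)"
          by (intro sum.cong) (auto simp: c_def)
        then show False using sp U hU by (auto simp: h_def)
      qed
      moreover from this have "sum cap (bd U) = Suc (sum c (bd U))"
        using finbd[of U] cu by (simp add: sum.remove[of _ u] c_def)
      ultimately show ?thesis
        using U hU sp by (auto simp: h_def tight_def)
    qed
    then have "U \<subseteq> M" "u \<in> U \<union> bd U" using tightM by auto
    then show "u \<in> sp cap M \<union> (bd M \<inter> P)"
      using uP cu by (auto simp: bd_def sp_def)
  qed
  \<comment> \<open>Each vertex of \<open>bd M\<close> in \<open>P\<close> has capacity at least
    one, so \<open>card P\<close> is at most \<open>h cap M\<close>.\<close>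
  have "card P \<le> card (sp cap M \<union> (bd M \<inter> P))"
    using finM[OF M] finbd by (intro card_mono PM) (auto simp: sp_def)
  also have "\<dots> \<le> card (sp cap M) + card (bd M \<inter> P)"
    by (rule card_Un_le)
  also have "card (bd M \<inter> P) \<le> sum cap (bd M)"
  proof -
    have "card (bd M \<inter> P) = sum (\<lambda>_. 1) (bd M \<inter> P)" by simp
    also have "\<dots> \<le> sum cap (bd M \<inter> P)"
      by (intro sum_mono) (auto simp: P_def sp_def)
    also have "\<dots> \<le> sum cap (bd M)"
      using finbd by (intro sum_mono2) auto
    finally show ?thesis .
  qed
  finally have cardP: "card P \<le> w * card C"
    using M by (simp add: tight_def h_def)
  have PA: "P \<subseteq> A" by (auto simp: P_def sp_def)
  have condP: "w * card C \<le> w * card ((C \<union> E `` U) \<inter> P - U) + card U" if U: "U \<subseteq> P" for U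
  proof -
    have "w * card C \<le> h cap U" using cap U PA by (auto simp: good_def)
    also have "sp cap U = U" using U by (auto simp: sp_def P_def)
    then have "h cap U = sum cap (bd U) + card U" by (simp add: h_def)
    also have "sum cap (bd U) = sum cap ((C \<union> E `` U) \<inter> P - U)"
      using finbd by (intro sum.mono_neutral_right) (auto simp: bd_def P_def sp_def)
    also have "\<dots> \<le> w * card ((C \<union> E `` U) \<inter> P - U)"
      using sum_bounded_above[of _ cap w] capw by (simp add: mult.commute)
    finally show ?thesis by simp
  qed
  \<comment> \<open>The condition for the empty cut forces all of \<open>C\<close> into
    \<open>P\<close>.\<close>
  have "w * card C \<le> w * card (C \<inter> P)"
    using condP[of "{}"] by simp
  then have "C \<inter> P = C"
    using w CA fin by (intro card_seteq) (auto intro: finite_subset)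
  then show ?thesis
    using that[of P] PA cardP condP by blast
qed

section \<open>Havens and bounded separation\<close>

definition separable :: "'a rel \<Rightarrow> 'a set \<Rightarrow> nat \<Rightarrow> bool" where
  "separable E V B \<longleftrightarrow> sym E \<and> 0 < B \<and>
     (\<forall>S. S \<subseteq> V \<longrightarrow> finite S \<longrightarrow> S \<noteq> {} \<longrightarrow>
       (\<exists>C\<subseteq>S. card C \<le> B \<and> (\<forall>x\<in>S - C. 2 * card (component E (S - C) x) < card S)))"

lemma
  assumes "separable E V B"
  shows separable_sym: "sym E" and separable_pos: "0 < B"
    and separable_separator: "\<lbrakk>S \<subseteq> V; finite S; S \<noteq> {}\<rbrakk> \<Longrightarrow>
      \<exists>C\<subseteq>S. card C \<le> B \<and> (\<forall>x\<in>S - C. 2 * card (component E (S - C) x) < card S)"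
  using assms by (simp_all add: separable_def)

text \<open>\<open>\<beta>\<close> is a haven: it picks a component of \<open>S - X\<close> for each
  small \<open>X\<close>, and the picked components pairwise meet. Let \<open>F\<close> be the
  minimum of \<open>w * card X + card (\<beta> X)\<close>. The set \<open>R\<close> has at most
  \<open>F\<close> vertices, and separating it would force \<open>F < 2 * w * B\<close>, while
  \<open>2 * B \<le> card C\<close> gives the opposite inequality.\<close>

lemma no_haven:
  assumes sep: "separable E V B" and "finite S" "S \<subseteq> V"
    and ne: "\<And>X. \<lbrakk>X \<subseteq> S; card X \<le> 7 * B\<rbrakk> \<Longrightarrow> \<beta> X \<noteq> {} \<and> \<beta> X \<subseteq> S - X"
    and comp: "\<And>X y. \<lbrakk>X \<subseteq> S; card X \<le> 7 * B; y \<in> \<beta> X\<rbrakk> \<Longrightarrow> \<beta> X = component E (S - X) y"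
    and meet: "\<And>X Y. \<lbrakk>X \<subseteq> S; card X \<le> 7 * B; Y \<subseteq> S; card Y \<le> 7 * B\<rbrakk> \<Longrightarrow> \<beta> X \<inter> \<beta> Y \<noteq> {}"
  shows False
proof -
  define adm where "adm X \<longleftrightarrow> X \<subseteq> S \<and> card X \<le> 7 * B" for X
  have ne: "\<beta> X \<noteq> {}" and sub: "\<beta> X \<subseteq> S - X"
    and comp: "y \<in> \<beta> X \<Longrightarrow> \<beta> X = component E (S - X) y" if "adm X" for X y
    using that ne comp by (auto simp: adm_def)
  have meet: "\<beta> X \<inter> \<beta> Y \<noteq> {}" if "adm X" "adm Y" for X Y
    using that meet by (simp add: adm_def)
  have fin: "finite X" if "X \<subseteq> S" for X
    using that assms(2) finite_subset by blast
  have adm_subset: "adm X" if "X \<subseteq> Y" "adm Y" for X Y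
    using that card_mono[OF fin that(1)] by (auto simp: adm_def)
  \<comment> \<open>The component picked for the larger set is connected in \<open>S - X\<close> and
    meets \<open>\<beta> X\<close>, so it lies inside it.\<close>
  have mono: "\<beta> Y \<subseteq> \<beta> X" if XY: "X \<subseteq> Y" "adm Y" for X Y
  proof -
    have "adm X" using XY by (rule adm_subset)
    then obtain y where "y \<in> \<beta> X" "y \<in> \<beta> Y" using meet XY(2) by blast
    then show ?thesis
      using comp[OF \<open>adm X\<close>, of y] comp[OF XY(2), of y] component_mono[OF Diff_mono[OF subset_refl XY(1)]]
      by metis
  qed
  have closed: "z \<in> \<beta> X" if "adm X" "y \<in> \<beta> X" "z \<in> S - X" "(y, z) \<in> E" for X y z
    using component_closed[of y E "S - X" y z] comp[OF that(1,2)] sub[OF that(1)] that by blast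
  have finb: "finite (\<beta> X)" if "adm X" for X
    using sub[OF that] by (auto intro: fin)
  define \<Phi> where "\<Phi> w X = w * card X + card (\<beta> X)" for w X
  define opt where "opt w C \<longleftrightarrow> adm C \<and> (\<forall>X. adm X \<longrightarrow> \<Phi> w C \<le> \<Phi> w X)" for w C
  have adm0: "adm {}" by (simp add: adm_def)
  have ex_opt: "\<exists>C. opt w C" for w
    using ex_has_least_nat[of adm "{}" "\<Phi> w"] adm0 by (auto simp: opt_def)
  define Q where "Q w \<longleftrightarrow> 0 < w \<and> (\<exists>C. opt w C \<and> 2 * B \<le> card C)" for w
  \<comment> \<open>For \<open>w = 1\<close>, adding a vertex of \<open>\<beta> C\<close> to
    \<open>C\<close> costs one and removes at least one vertex from \<open>\<beta> C\<close>. So a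
    minimiser with fewer than \<open>2 * B\<close> vertices can be enlarged.\<close>
  have "Q 1"
  proof -
    obtain C0 where "opt 1 C0" using ex_opt by blast
    moreover have "\<forall>C. opt 1 C \<longrightarrow> card C < Suc (7 * B)" by (simp add: opt_def adm_def)
    ultimately obtain C where C: "opt 1 C" and Cmax: "\<And>D. opt 1 D \<Longrightarrow> card D \<le> card C"
      using ex_has_greatest_nat[of "opt 1" C0 card] by metis
    have "2 * B \<le> card C"
    proof (rule ccontr)
      assume less: "\<not> 2 * B \<le> card C"
      have admC: "adm C" using C by (simp add: opt_def)
      obtain v where v: "v \<in> \<beta> C" using ne[OF admC] by blast
      then have vC: "v \<in> S" "v \<notin> C" using sub[OF admC] by auto
      have finC: "finite C" using admC fin by (auto simp: adm_def)
      have adm: "adm (insert v C)"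
        using admC less vC finC by (auto simp: adm_def)
      have "\<beta> (insert v C) \<subseteq> \<beta> C - {v}"
        using mono[of C "insert v C"] sub[OF adm] adm by auto
      then have "card (\<beta> (insert v C)) \<le> card (\<beta> C - {v})"
        using finb[OF admC] by (intro card_mono) auto
      moreover have "0 < card (\<beta> C)" using v finb[OF admC] by (auto simp: card_gt_0_iff)
      ultimately have "\<Phi> 1 (insert v C) \<le> \<Phi> 1 C"
        using v finC vC by (simp add: \<Phi>_def)
      then have "opt 1 (insert v C)"
        using C adm by (auto simp: opt_def intro: order_trans)
      then have "card (insert v C) \<le> card C" by (rule Cmax)
      then show False using finC vC by simp
    qed
    then show ?thesis using C by (auto simp: Q_def)
  qed
  \<comment> \<open>Comparison with the empty set: \<open>w\<close> is at most
    \<open>\<Phi> w C\<close>, hence at most \<open>\<Phi> w {}\<close>, hence at most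
    \<open>card S\<close>.\<close>
  moreover have "w < Suc (card S)" if "Q w" for w
  proof -
    obtain C where C: "opt w C" "2 * B \<le> card C" using \<open>Q w\<close> by (auto simp: Q_def)
    have "w * 1 \<le> w * card C" using C(2) separable_pos[OF sep] by (intro mult_le_mono2) simp
    also have "\<dots> \<le> \<Phi> w C" by (simp add: \<Phi>_def)
    also have "\<dots> \<le> \<Phi> w {}" using C(1) adm0 by (simp add: opt_def)
    also have "\<dots> \<le> card S"
      using sub[OF adm0] assms(2) by (auto simp: \<Phi>_def intro: card_mono)
    finally show ?thesis by simp
  qed
  \<comment> \<open>Maximality of \<open>w\<close> keeps the minimisers for \<open>Suc w\<close> small; comparison with one of them bounds
    \<open>card C\<close> from above.\<close>
  ultimately obtain w where "Q w" and wmax: "\<And>v. Q v \<Longrightarrow> v \<le> w"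
    using ex_has_greatest_nat[of Q 1 "\<lambda>w. w" "Suc (card S)"] by blast
  then obtain C where w: "0 < w" and C: "opt w C" "2 * B \<le> card C" by (auto simp: Q_def)
  have "\<not> Q (Suc w)" using wmax[of "Suc w"] by auto
  moreover obtain C1 where C1: "opt (Suc w) C1" using ex_opt by blast
  ultimately have cardC1: "card C1 < 2 * B" by (auto simp: Q_def not_le)
  have admC1: "adm C1" and admC: "adm C" using C1 C by (auto simp: opt_def)
  \<comment> \<open>Cutting \<open>\<beta> C1\<close> with at most \<open>B\<close> further vertices
    leaves less than half of it. Minimality for \<open>Suc w\<close> makes this gain at most the
    price \<open>Suc w * B\<close>.\<close>
  have small: "card (\<beta> C1) < 2 * (Suc w * B)"
  proof -
    obtain X where X: "X \<subseteq> \<beta> C1" "card X \<le> B"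
      "\<And>x. x \<in> \<beta> C1 - X \<Longrightarrow> 2 * card (component E (\<beta> C1 - X) x) < card (\<beta> C1)"
      using separable_separator[OF sep, of "\<beta> C1"] sub[OF admC1] ne[OF admC1] finb[OF admC1] assms(3) by blast
    have cardU: "card (C1 \<union> X) \<le> card C1 + B"
      using card_Un_le[of C1 X] X(2) by simp
    then have adm: "adm (C1 \<union> X)"
      using admC1 X(1) sub[OF admC1] cardC1 by (auto simp: adm_def)
    obtain y where y: "y \<in> \<beta> (C1 \<union> X)" using ne[OF adm] by blast
    have inC1: "\<beta> (C1 \<union> X) \<subseteq> \<beta> C1" using mono adm by blast
    have y': "y \<in> \<beta> C1 - X" using y inC1 sub[OF adm] by auto
    have "\<beta> (C1 \<union> X) \<subseteq> component E (\<beta> C1 - X) y"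
      unfolding comp[OF adm y]
    proof (rule component_least)
      fix u z
      assume u: "u \<in> component E (\<beta> C1 - X) y" and uz: "z \<in> S - (C1 \<union> X)" "(u, z) \<in> E"
      have "u \<in> \<beta> C1 - X" using u component_subset[OF y'] by blast
      moreover from this have "z \<in> \<beta> C1" using closed[OF admC1, of u z] uz by auto
      ultimately show "z \<in> component E (\<beta> C1 - X) y"
        using component_closed[OF u uz(2)] uz(1) by auto
    qed simp
    then have "card (\<beta> (C1 \<union> X)) \<le> card (component E (\<beta> C1 - X) y)"
      using component_subset[OF y'] finb[OF admC1] by (intro card_mono) (auto intro: finite_subset)
    with X(3)[OF y'] have "2 * card (\<beta> (C1 \<union> X)) < card (\<beta> C1)" by simp
    moreover have "\<Phi> (Suc w) C1 \<le> \<Phi> (Suc w) (C1 \<union> X)"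
      using C1 adm by (simp add: opt_def)
    moreover have "Suc w * card (C1 \<union> X) \<le> Suc w * card C1 + Suc w * B"
      using mult_le_mono2[OF cardU, of "Suc w"] by (simp only: add_mult_distrib2)
    ultimately show ?thesis unfolding \<Phi>_def by linarith
  qed
  \<comment> \<open>The bound \<open>6 * B\<close> leaves room for one more separator of
    \<open>B\<close> vertices; this is where \<open>7 * B\<close> comes from.\<close>
  have cardC: "card C < 6 * B"
  proof -
    have "w * card C \<le> \<Phi> w C1"
      using C(1) admC1 by (auto simp: opt_def \<Phi>_def)
    also have "\<dots> < w * (2 * B) + 2 * (Suc w * B)"
      using small mult_le_mono2[of "card C1" "2 * B" w] cardC1
      unfolding \<Phi>_def by linarith
    also have "\<dots> \<le> w * (2 * B) + 2 * ((2 * w) * B)"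
      using w by (intro add_mono mult_le_mono) auto
    finally have "w * card C < w * (6 * B)" by (simp add: algebra_simps)
    then show ?thesis by simp
  qed
  define F where "F = \<Phi> w C"
  have F: "F \<le> w * card X + card (\<beta> X)" if "adm X" for X
    using C(1) that by (simp add: F_def opt_def \<Phi>_def)
  have F_eq: "F = w * card C + card (\<beta> C)" by (simp add: F_def \<Phi>_def)
  have CS: "C \<subseteq> S - \<beta> C" using admC sub[OF admC] by (auto simp: adm_def)
  \<comment> \<open>If \<open>card X \<le> card C\<close>, then \<open>X\<close> is admissible and
    confines \<open>\<beta> X\<close> to \<open>\<beta> C \<union> U\<close>, so optimality of
    \<open>C\<close> gives the cut condition. A larger \<open>X\<close> satisfies it at
    once.\<close>
  have cond: "w * card C \<le> w * card ((C \<union> E `` U) \<inter> (S - \<beta> C) - U) + card U"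
    if U: "U \<subseteq> S - \<beta> C" for U
  proof -
    define X where "X = (C \<union> E `` U) \<inter> (S - \<beta> C) - U"
    show ?thesis
    proof (cases "card X \<le> card C")
      case False
      then have "w * card C \<le> w * card X" by (intro mult_le_mono2) simp
      then show ?thesis unfolding X_def by linarith
    next
      case True
      then have admX: "adm X" using cardC by (auto simp: adm_def X_def)
      obtain y where y: "y \<in> \<beta> X" "y \<in> \<beta> C" using meet admX admC by blast
      have "\<beta> X \<subseteq> \<beta> C \<union> U"
        unfolding comp[OF admX y(1)]
      proof (rule component_least)
        fix u z
        assume u: "u \<in> \<beta> C \<union> U" and z: "z \<in> S - X" "(u, z) \<in> E"
        then show "z \<in> \<beta> C \<union> U"
          using closed[OF admC, of u z] by (auto simp: X_def)
      qed (use y in auto)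
      then have "card (\<beta> X) \<le> card (\<beta> C \<union> U)"
        using finb[OF admC] fin[of U] U by (intro card_mono) auto
      also have "\<dots> \<le> card (\<beta> C) + card U" by (rule card_Un_le)
      finally show ?thesis
        using F[OF admX] F_eq unfolding X_def by linarith
    qed
  qed
  have finSC: "finite (S - \<beta> C)" using assms(2) by simp
  obtain P where P: "C \<subseteq> P" "P \<subseteq> S - \<beta> C" "card P \<le> w * card C"
    and condP: "\<And>U. U \<subseteq> P \<Longrightarrow> w * card C \<le> w * card ((C \<union> E `` U) \<inter> P - U) + card U"
    using small_conducting_subset[OF finSC CS w cond] by blast
  have finP: "finite P" using P(2) finSC finite_subset by blast
  have finC: "finite C" using P(1) finP finite_subset by blast
  define R where "R = \<beta> C \<union> P"
  have finR: "finite R" using finP finb[OF admC] by (simp add: R_def)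
  have "card R \<le> F"
    using card_Un_le[of "\<beta> C" P] P(3) by (simp add: R_def F_eq)
  moreover obtain X where X: "X \<subseteq> R" "card X \<le> B"
    and Xcomp: "\<And>x. x \<in> R - X \<Longrightarrow> 2 * card (component E (R - X) x) < card R"
  proof -
    have "R \<subseteq> V" "R \<noteq> {}"
      using P(2) sub[OF admC] ne[OF admC] assms(3) by (auto simp: R_def)
    then show ?thesis using separable_separator[OF sep, of R] finR that by blast
  qed
  have RS: "R \<subseteq> S" using P(2) sub[OF admC] by (auto simp: R_def)
  have admCX: "adm (C \<union> X)"
    using card_Un_le[of C X] cardC X RS CS by (auto simp: adm_def)
  obtain y where y: "y \<in> \<beta> (C \<union> X)" using ne[OF admCX] by blast
  have y': "y \<in> \<beta> C" "y \<notin> X" using y mono[of C "C \<union> X"] admCX sub[OF admCX] by auto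
  define Y where "Y = component E (R - X) y"
  have YR: "Y \<subseteq> R - X" unfolding Y_def by (rule component_subset) (use y' in \<open>auto simp: R_def\<close>)
  have yY: "y \<in> Y" by (simp add: Y_def)
  have Yclosed: "z \<in> Y" if "u \<in> Y" "z \<in> R - X" "(u, z) \<in> E" for u z
    using that YR component_closed[of u E "R - X" y z] by (auto simp: Y_def)
  have "2 * card Y < card R" unfolding Y_def by (rule Xcomp) (use y' in \<open>auto simp: R_def\<close>)
  \<comment> \<open>\<open>C'\<close> competes with \<open>C\<close>: it keeps from \<open>X\<close>
    what lies in \<open>\<beta> C \<union> C\<close>, and from \<open>C\<close> what lies in
    \<open>Y\<close>. Every way out of \<open>Y \<inter> \<beta> C\<close> is then blocked.\<close>
  define C' where "C' = X \<inter> (\<beta> C \<union> C) \<union> C \<inter> Y"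
  have admC': "adm C'" using admCX by (rule adm_subset[rotated]) (auto simp: C'_def)
  have yC': "y \<in> \<beta> C'" using mono[of C' "C \<union> X"] y admCX by (auto simp: C'_def)
  have "\<beta> C' \<subseteq> Y \<inter> \<beta> C"
    unfolding comp[OF admC' yC']
  proof (rule component_least)
    fix u z
    assume u: "u \<in> Y \<inter> \<beta> C" and z: "z \<in> S - C'" "(u, z) \<in> E"
    have z': "z \<in> \<beta> C \<union> C" using closed[OF admC, of u z] u z by auto
    then have "z \<in> Y" using Yclosed[of u z] u z P(1) by (auto simp: C'_def R_def)
    then show "z \<in> Y \<inter> \<beta> C" using z z' by (auto simp: C'_def)
  qed (use yY y' in auto)
  then have "card (\<beta> C') \<le> card (Y \<inter> \<beta> C)"
    using finb[OF admC] by (intro card_mono) auto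
  moreover have "card C' \<le> card (X \<inter> (\<beta> C \<union> C)) + card (C \<inter> Y)"
    unfolding C'_def by (rule card_Un_le)
  ultimately have 1: "F \<le> w * (card (X \<inter> (\<beta> C \<union> C)) + card (C \<inter> Y)) + card (Y \<inter> \<beta> C)"
    using F[OF admC'] by (meson add_mono mult_le_mono2 order_trans)
  have finX: "finite X" using X(1) finR finite_subset by blast
  \<comment> \<open>The cut condition for \<open>U = Y \<inter> P\<close>: an edge of
    \<open>R\<close> that leaves \<open>Y\<close> ends in \<open>X\<close>.\<close>
  have "(C \<union> E `` (Y \<inter> P)) \<inter> P - Y \<inter> P \<subseteq> (C - Y) \<union> (X \<inter> P - C)"
    using Yclosed by (auto simp: R_def)
  then have "card ((C \<union> E `` (Y \<inter> P)) \<inter> P - Y \<inter> P) \<le> card ((C - Y) \<union> (X \<inter> P - C))"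
    using finC finX by (intro card_mono) auto
  also have "\<dots> \<le> card (C - Y) + card (X \<inter> P - C)" by (rule card_Un_le)
  finally have 2: "w * card C \<le> w * (card (C - Y) + card (X \<inter> P - C)) + card (Y \<inter> P)"
    using condP[of "Y \<inter> P"] by (meson Int_lower2 add_le_mono1 mult_le_mono2 order_trans)
  have 3: "card C = card (C \<inter> Y) + card (C - Y)"
    using finC by (subst card_Un_disjoint[symmetric]) (auto intro: arg_cong[of _ _ card])
  have "card X = card (X \<inter> (\<beta> C \<union> C)) + card (X \<inter> P - C)"
    using finX X(1) P(2)
    by (subst card_Un_disjoint[symmetric]) (auto simp: R_def intro!: arg_cong[of _ _ card])
  then have "w * (card (X \<inter> (\<beta> C \<union> C)) + card (X \<inter> P - C)) \<le> w * B"
    using X(2) by simp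
  moreover have "card Y = card (Y \<inter> \<beta> C) + card (Y \<inter> P)"
    using finP finb[OF admC] YR P(2)
    by (subst card_Un_disjoint[symmetric]) (auto simp: R_def intro!: arg_cong[of _ _ card])
  moreover have "w * (2 * B) \<le> w * card C" using C(2) by (intro mult_le_mono2)
  \<comment> \<open>Adding the two estimates gives \<open>F \<le> w * B + card Y\<close>. As
    \<open>2 * card Y < F\<close>, it follows that \<open>F < 2 * w * B\<close>, which is at most
    \<open>w * card C\<close> and so at most \<open>F\<close>.\<close>
  ultimately show False
    using 1 2 3 F_eq \<open>2 * card Y < card R\<close> \<open>card R \<le> F\<close> by (simp add: algebra_simps)
qed

section \<open>Compactness and iterated halving\<close>

text \<open>A compactness argument: \<open>C\<close> is a set of maximal size contained in
  \<open>c F'\<close> for cofinally many finite \<open>F'\<close>. For each \<open>x\<close> in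
  \<open>F - C\<close> the set \<open>insert x C\<close> fails beyond some finite
  \<open>G x\<close>. A suitable \<open>F'\<close> beyond all of these chooses nothing in
  \<open>F\<close> outside \<open>C\<close>.\<close>

lemma cofinal_bounded_choice:
  fixes c :: "'a set \<Rightarrow> 'a set"
  assumes c: "\<And>F. \<lbrakk>finite F; F \<subseteq> S\<rbrakk> \<Longrightarrow> c F \<subseteq> F \<and> card (c F) \<le> k"
  obtains C where "C \<subseteq> S" "finite C" "card C \<le> k"
    "\<And>F. \<lbrakk>finite F; F \<subseteq> S\<rbrakk> \<Longrightarrow> \<exists>F'. finite F' \<and> F \<subseteq> F' \<and> F' \<subseteq> S \<and> c F' \<inter> F \<subseteq> C"
proof -
  define cofinal where "cofinal C \<longleftrightarrow>
    (\<forall>F. finite F \<and> F \<subseteq> S \<longrightarrow> (\<exists>F'. finite F' \<and> F \<subseteq> F' \<and> F' \<subseteq> S \<and> C \<subseteq> c F'))" for C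
  have bound: "C \<subseteq> S \<and> finite C \<and> card C \<le> k" if cof: "cofinal C" for C
  proof -
    obtain F where F: "finite F" "F \<subseteq> S" "C \<subseteq> c F"
      using cof[unfolded cofinal_def, rule_format, of "{}"] by auto
    then have "c F \<subseteq> F" "card (c F) \<le> k" using c by blast+
    moreover from this have "finite (c F)" using F(1) finite_subset by blast
    ultimately show ?thesis
      using F card_mono[of "c F" C] finite_subset[of C "c F"] by auto
  qed
  have "cofinal {}" by (auto simp: cofinal_def)
  moreover have "\<forall>C. cofinal C \<longrightarrow> card C < Suc k" using bound by (simp add: less_Suc_eq_le)
  ultimately obtain C where C: "cofinal C" and Cmax: "\<And>D. cofinal D \<Longrightarrow> card D \<le> card C"
    using ex_has_greatest_nat[of cofinal "{}" card "Suc k"] by metis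
  have "\<exists>F'. finite F' \<and> F \<subseteq> F' \<and> F' \<subseteq> S \<and> c F' \<inter> F \<subseteq> C" if F: "finite F" "F \<subseteq> S" for F
  proof -
    have "\<exists>G. finite G \<and> G \<subseteq> S \<and> (\<forall>F'. finite F' \<and> G \<subseteq> F' \<and> F' \<subseteq> S \<longrightarrow> \<not> insert x C \<subseteq> c F')"
      if "x \<in> F - C" for x
    proof -
      have "card (insert x C) = Suc (card C)" using that bound[OF C] by simp
      then have "\<not> cofinal (insert x C)" using Cmax[of "insert x C"] by auto
      then obtain F0 where "finite F0" "F0 \<subseteq> S" "\<not> (\<exists>F'. finite F' \<and> F0 \<subseteq> F' \<and> F' \<subseteq> S \<and> insert x C \<subseteq> c F')"
        unfolding cofinal_def by metis
      then show ?thesis by metis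
    qed
    then obtain G where G: "\<And>x. x \<in> F - C \<Longrightarrow> finite (G x) \<and> G x \<subseteq> S \<and>
        (\<forall>F'. finite F' \<and> G x \<subseteq> F' \<and> F' \<subseteq> S \<longrightarrow> \<not> insert x C \<subseteq> c F')"
      by metis
    have "finite (F \<union> (\<Union>x\<in>F - C. G x))" "F \<union> (\<Union>x\<in>F - C. G x) \<subseteq> S"
      using F G by auto
    then obtain F' where F': "finite F'" "F \<union> (\<Union>x\<in>F - C. G x) \<subseteq> F'" "F' \<subseteq> S" "C \<subseteq> c F'"
      using C[unfolded cofinal_def, rule_format, of "F \<union> (\<Union>x\<in>F - C. G x)"] by blast
    have "c F' \<inter> F \<subseteq> C"
    proof
      fix x assume x: "x \<in> c F' \<inter> F"
      show "x \<in> C"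
      proof (rule ccontr)
        assume "x \<notin> C"
        then have "x \<in> F - C" using x by simp
        then have "G x \<subseteq> F'" "\<not> insert x C \<subseteq> c F'" using G[of x] F'(1-3) by blast+
        then show False using F'(4) x by blast
      qed
    qed
    then show ?thesis using F' by blast
  qed
  then show ?thesis using that[of C] bound[OF C] by simp
qed

text \<open>Otherwise each small set leaves a component with more than half of \<open>W\<close>. Any
  two such components share a vertex of \<open>W\<close>, so they form a haven.\<close>

lemma weighted_separator:
  assumes sep: "separable E V B" and "finite S" "S \<subseteq> V" "finite W"
  shows "\<exists>C\<subseteq>S. card C \<le> 7 * B \<and> (\<forall>x\<in>S - C. 2 * card (component E (S - C) x \<inter> W) \<le> card W)"
proof (rule ccontr)
  assume "\<not> ?thesis"
  then have "\<exists>x\<in>S - C. card W < 2 * card (component E (S - C) x \<inter> W)"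
    if "C \<subseteq> S" "card C \<le> 7 * B" for C
    using that by (meson not_le)
  then obtain b where b: "\<And>C. \<lbrakk>C \<subseteq> S; card C \<le> 7 * B\<rbrakk> \<Longrightarrow>
      b C \<in> S - C \<and> card W < 2 * card (component E (S - C) (b C) \<inter> W)"
    by metis
  define \<beta> where "\<beta> C = component E (S - C) (b C)" for C
  show False
  proof (rule no_haven[OF sep assms(2,3), of \<beta>])
    fix X assume X: "X \<subseteq> S" "card X \<le> 7 * B"
    have "b X \<in> \<beta> X" by (simp add: \<beta>_def)
    moreover have "\<beta> X \<subseteq> S - X"
      unfolding \<beta>_def using b[OF X] by (intro component_subset) simp
    ultimately show "\<beta> X \<noteq> {} \<and> \<beta> X \<subseteq> S - X" by blast
    show "\<beta> X = component E (S - X) y" if "y \<in> \<beta> X" for y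
      using component_eq[OF separable_sym[OF sep] that[unfolded \<beta>_def]] by (simp add: \<beta>_def)
    fix Y assume Y: "Y \<subseteq> S" "card Y \<le> 7 * B"
    show "\<beta> X \<inter> \<beta> Y \<noteq> {}"
    proof
      assume "\<beta> X \<inter> \<beta> Y = {}"
      then have "card (\<beta> X \<inter> W) + card (\<beta> Y \<inter> W) = card ((\<beta> X \<inter> W) \<union> (\<beta> Y \<inter> W))"
        using assms(4) by (intro card_Un_disjoint[symmetric]) auto
      also have "\<dots> \<le> card W"
        using assms(4) by (intro card_mono) auto
      finally show False
        using b[OF X] b[OF Y] by (simp add: \<beta>_def)
    qed
  qed
qed

text \<open>Repeated halving. In each round only the components with too much of \<open>W\<close>
  are cut again. There are at most \<open>2 ^ Suc m\<close> of them, at a cost of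
  \<open>7 * B\<close> each, which just doubles the total bound.\<close>

lemma weighted_separator_pow:
  assumes sep: "separable E V B" and "finite S" "S \<subseteq> V" "finite W"
  shows "\<exists>C\<subseteq>S. card C \<le> 14 * B * 2 ^ m \<and>
    (\<forall>x\<in>S - C. 2 ^ m * card (component E (S - C) x \<inter> W) \<le> card W)"
proof (induction m)
  case 0
  show ?case
    using assms(4) by (intro exI[of _ "{}"]) (auto intro: card_mono)
next
  case (Suc m)
  then obtain C where C: "C \<subseteq> S" "card C \<le> 14 * B * 2 ^ m"
    "\<And>x. x \<in> S - C \<Longrightarrow> 2 ^ m * card (component E (S - C) x \<inter> W) \<le> card W"
    by blast
  define H where "H = {K \<in> component E (S - C) ` (S - C). card W < 2 ^ Suc m * card (K \<inter> W)}"
  have finH: "finite H" using assms(2) by (simp add: H_def)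
  have HS: "K \<subseteq> S - C" if "K \<in> H" for K
  proof -
    obtain x where "x \<in> S - C" "K = component E (S - C) x" using \<open>K \<in> H\<close> unfolding H_def by blast
    then show ?thesis using component_subset[of x "S - C" E] by metis
  qed
  have disj: "K \<inter> W \<inter> (L \<inter> W) = {}" if "K \<in> H" "L \<in> H" "K \<noteq> L" for K L
  proof (rule ccontr)
    assume "K \<inter> W \<inter> (L \<inter> W) \<noteq> {}"
    then obtain y where "y \<in> K" "y \<in> L" by blast
    moreover have "M = component E (S - C) y" if "M \<in> H" "y \<in> M" for M
    proof -
      obtain x where "M = component E (S - C) x" using \<open>M \<in> H\<close> unfolding H_def by blast
      then show ?thesis using component_eq[OF separable_sym[OF sep]] \<open>y \<in> M\<close> by simp
    qed
    ultimately show False using that by metis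
  qed
  have "card H \<le> 2 ^ Suc m"
  proof -
    \<comment> \<open>The summand one turns the strict bound defining \<open>H\<close> into a weak
      one and keeps the cancelled factor positive even for empty \<open>W\<close>.\<close>
    have "card H * (card W + 1) = (\<Sum>K\<in>H. card W + 1)" by simp
    also have "\<dots> \<le> (\<Sum>K\<in>H. 2 ^ Suc m * card (K \<inter> W))"
      by (intro sum_mono) (simp add: H_def)
    also have "\<dots> = 2 ^ Suc m * card (\<Union>K\<in>H. K \<inter> W)"
      using finH assms(4) disj
      by (subst card_UN_disjoint) (auto simp: sum_distrib_left)
    also have "\<dots> \<le> 2 ^ Suc m * (card W + 1)"
      using assms(4) by (intro mult_le_mono2 trans_le_add1 card_mono) auto
    finally show ?thesis by (simp only: mult_le_cancel2)
  qed
  have "\<exists>c\<subseteq>K. card c \<le> 7 * B \<and> (\<forall>x\<in>K - c. 2 * card (component E (K - c) x \<inter> (K \<inter> W)) \<le> card (K \<inter> W))"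
    if "K \<in> H" for K
  proof (rule weighted_separator[OF sep])
    show "finite K" using HS[OF that] assms(2) by (metis finite_Diff finite_subset)
    show "K \<subseteq> V" using HS[OF that] assms(3) by blast
    show "finite (K \<inter> W)" using assms(4) by simp
  qed
  then obtain c where c: "\<And>K. K \<in> H \<Longrightarrow> c K \<subseteq> K \<and> card (c K) \<le> 7 * B \<and>
      (\<forall>x\<in>K - c K. 2 * card (component E (K - c K) x \<inter> (K \<inter> W)) \<le> card (K \<inter> W))"
    by metis
  define C' where "C' = C \<union> (\<Union>K\<in>H. c K)"
  have "c K \<subseteq> S" if "K \<in> H" for K using c[OF that] HS[OF that] by blast
  then have "C' \<subseteq> S" using C(1) by (auto simp: C'_def)
  moreover have "card C' \<le> 14 * B * 2 ^ Suc m"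
  proof -
    have "card C' \<le> card C + card (\<Union>K\<in>H. c K)" unfolding C'_def by (rule card_Un_le)
    also have "card (\<Union>K\<in>H. c K) \<le> (\<Sum>K\<in>H. card (c K))" by (rule card_UN_le[OF finH])
    also have "\<dots> \<le> card H * (7 * B)" using sum_bounded_above[of H "\<lambda>K. card (c K)" "7 * B"] c by simp
    also have "\<dots> \<le> 2 ^ Suc m * (7 * B)" using \<open>card H \<le> 2 ^ Suc m\<close> by (intro mult_le_mono1)
    finally show ?thesis using C(2) by (simp add: algebra_simps)
  qed
  moreover have "2 ^ Suc m * card (component E (S - C') x \<inter> W) \<le> card W" if x: "x \<in> S - C'" for x
  proof -
    define K where "K = component E (S - C) x"
    have xC: "x \<in> S - C" using x by (auto simp: C'_def)
    have sub: "component E (S - C') x \<subseteq> K"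
      unfolding K_def by (rule component_mono) (auto simp: C'_def)
    show ?thesis
    proof (cases "K \<in> H")
      case False
      then have "2 ^ Suc m * card (K \<inter> W) \<le> card W"
        using xC by (auto simp: H_def K_def not_less)
      moreover have "card (component E (S - C') x \<inter> W) \<le> card (K \<inter> W)"
        using sub assms(4) by (intro card_mono) auto
      ultimately show ?thesis by (meson mult_le_mono2 order_trans)
    next
      case True
      have "component E (S - C') x \<subseteq> component E (K - c K) x"
        using x True by (intro component_transfer[of x "S - C'" "S - C"]) (auto simp: C'_def K_def)
      then have "component E (S - C') x \<inter> W \<subseteq> component E (K - c K) x \<inter> (K \<inter> W)"
        using sub by auto
      then have "card (component E (S - C') x \<inter> W) \<le> card (component E (K - c K) x \<inter> (K \<inter> W))"
        using assms(4) by (intro card_mono) auto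
      moreover have "x \<in> K - c K" using x True by (auto simp: C'_def K_def)
      then have "2 * card (component E (K - c K) x \<inter> (K \<inter> W)) \<le> card (K \<inter> W)"
        using c[OF True] by blast
      ultimately have "2 * card (component E (S - C') x \<inter> W) \<le> card (K \<inter> W)"
        by linarith
      then have "2 ^ m * (2 * card (component E (S - C') x \<inter> W)) \<le> 2 ^ m * card (K \<inter> W)"
        by (rule mult_le_mono2)
      also have "\<dots> \<le> card W" using C(3)[OF xC] by (simp add: K_def)
      finally show ?thesis by (simp add: ac_simps)
    qed
  qed
  ultimately show ?case by (intro exI[of _ C']) simp
qed

text \<open>The part of \<open>W\<close> in a component of \<open>S - C\<close> is joined to
  \<open>x\<close> by finitely many paths. A suitable finite \<open>F'\<close> has a separator that
  misses these paths, so its bound carries over to \<open>S\<close>.\<close>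

lemma weighted_separator_infinite:
  assumes sep: "separable E V B" and "S \<subseteq> V" "finite W"
  shows "\<exists>C\<subseteq>S. finite C \<and> card C \<le> 14 * B * 2 ^ m \<and>
    (\<forall>x\<in>S - C. 2 ^ m * card (component E (S - C) x \<inter> W) \<le> card W)"
proof -
  have "\<exists>C\<subseteq>F. card C \<le> 14 * B * 2 ^ m \<and>
      (\<forall>x\<in>F - C. 2 ^ m * card (component E (F - C) x \<inter> W) \<le> card W)"
    if "finite F" "F \<subseteq> S" for F
    using that assms by (intro weighted_separator_pow[OF sep]) auto
  then obtain c where c: "\<And>F. \<lbrakk>finite F; F \<subseteq> S\<rbrakk> \<Longrightarrow> c F \<subseteq> F \<and> card (c F) \<le> 14 * B * 2 ^ m \<and>
      (\<forall>x\<in>F - c F. 2 ^ m * card (component E (F - c F) x \<inter> W) \<le> card W)"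
    by metis
  then obtain C where C: "C \<subseteq> S" "finite C" "card C \<le> 14 * B * 2 ^ m"
    and cofinal: "\<And>F. \<lbrakk>finite F; F \<subseteq> S\<rbrakk> \<Longrightarrow> \<exists>F'. finite F' \<and> F \<subseteq> F' \<and> F' \<subseteq> S \<and> c F' \<inter> F \<subseteq> C"
    using cofinal_bounded_choice[of S c "14 * B * 2 ^ m"] by metis
  have "2 ^ m * card (component E (S - C) x \<inter> W) \<le> card W" if x: "x \<in> S - C" for x
  proof -
    define W' where "W' = component E (S - C) x \<inter> W"
    have "\<exists>F. finite F \<and> F \<subseteq> S - C \<and> y \<in> component E F x" if "y \<in> W'" for y
    proof -
      have "y \<in> component E (S - C) x" using that by (simp add: W'_def)
      then show ?thesis using x component_finitary by metis
    qed
    then obtain f where f: "\<And>y. y \<in> W' \<Longrightarrow> finite (f y) \<and> f y \<subseteq> S - C \<and> y \<in> component E (f y) x"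
      by metis
    define F where "F = insert x (\<Union>y\<in>W'. f y)"
    have F: "finite F" "F \<subseteq> S - C"
      using f x assms(3) by (auto simp: F_def W'_def)
    then obtain F' where F': "finite F'" "F \<subseteq> F'" "F' \<subseteq> S" "c F' \<inter> F \<subseteq> C"
      using cofinal[of F] by blast
    have sub: "F \<subseteq> F' - c F'" using F F' by auto
    have "W' \<subseteq> component E (F' - c F') x"
    proof
      fix y assume y: "y \<in> W'"
      have "f y \<subseteq> F" using y unfolding F_def by blast
      then show "y \<in> component E (F' - c F') x"
        using f[OF y] component_mono[of "f y" "F' - c F'" E x] sub by blast
    qed
    then have "card W' \<le> card (component E (F' - c F') x \<inter> W)"
      using assms(3) by (intro card_mono) (auto simp: W'_def)
    then have "2 ^ m * card W' \<le> 2 ^ m * card (component E (F' - c F') x \<inter> W)"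
      by (rule mult_le_mono2)
    also have "x \<in> F' - c F'" using sub unfolding F_def by blast
    then have "2 ^ m * card (component E (F' - c F') x \<inter> W) \<le> card W"
      using c[OF F'(1,3)] by blast
    finally show ?thesis by (simp add: W'_def)
  qed
  then show ?thesis using C by (intro exI[of _ C]) simp
qed

section \<open>Bags of bounded size\<close>

lemma card_Image_le:
  assumes "finite X" "\<And>x. x \<in> X \<Longrightarrow> finite (E `` {x}) \<and> card (E `` {x}) \<le> D"
  shows "finite (E `` X)" "card (E `` X) \<le> D * card X"
proof -
  have eq: "E `` X = (\<Union>x\<in>X. E `` {x})" by auto
  show "finite (E `` X)" unfolding eq using assms by auto
  have "card (E `` X) \<le> (\<Sum>x\<in>X. card (E `` {x}))" unfolding eq by (rule card_UN_le[OF assms(1)])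
  also have "\<dots> \<le> D * card X"
    using sum_bounded_above[of X "\<lambda>x. card (E `` {x})" D] assms(2) by (simp add: mult.commute)
  finally show "card (E `` X) \<le> D * card X" .
qed

text \<open>The bound \<open>K\<close> on the boundary has to reproduce itself when passing to a
  component. The bag is \<open>R\<close> together with a separator of the neighbours of
  \<open>R\<close>.\<close>

lemma bag_exists:
  assumes sep: "separable E V B" and D_pos: "0 < D"
    and degree: "\<forall>x\<in>V. finite (E `` {x}) \<and> card (E `` {x}) \<le> D"
  obtains K L where "0 < K"
    "\<And>S R. \<lbrakk>S \<subseteq> V; R \<subseteq> S; finite R; card R \<le> K\<rbrakk> \<Longrightarrow>
       \<exists>X. R \<subseteq> X \<and> X \<subseteq> S \<and> finite X \<and> card X \<le> L \<and>
         (\<forall>v\<in>S - X. card (E `` X \<inter> component E (S - X) v) \<le> K)"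
proof -
  define q where "q = 14 * B * 2 ^ Suc D"
  \<comment> \<open>Half of \<open>K\<close> pays for the at most \<open>q * D\<close> neighbours of
    the separator. The other half pays for the neighbours of \<open>R\<close>: at most
    \<open>D * K\<close> in all, reduced in each component by the factor \<open>2 ^ Suc D\<close>,
    which is at least \<open>2 * D\<close>.\<close>
  define K where "K = 2 * (q * D)"
  have "\<exists>X. R \<subseteq> X \<and> X \<subseteq> S \<and> finite X \<and> card X \<le> K + q \<and>
      (\<forall>v\<in>S - X. card (E `` X \<inter> component E (S - X) v) \<le> K)"
    if SR: "S \<subseteq> V" "R \<subseteq> S" "finite R" "card R \<le> K" for S R
  proof -
    have W: "finite (E `` R)" "card (E `` R) \<le> D * card R"
      using card_Image_le[of R E D] degree SR by blast+
    obtain C where C: "C \<subseteq> S" "finite C" "card C \<le> q"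
      "\<And>x. x \<in> S - C \<Longrightarrow> 2 ^ Suc D * card (component E (S - C) x \<inter> E `` R) \<le> card (E `` R)"
      using weighted_separator_infinite[OF sep SR(1) W(1), of "Suc D"] unfolding q_def by blast
    have NC: "finite (E `` C)" "card (E `` C) \<le> D * card C"
      using card_Image_le[of C E D] degree SR(1) C(1,2) by blast+
    have "card (E `` (R \<union> C) \<inter> component E (S - (R \<union> C)) v) \<le> K" if v: "v \<in> S - (R \<union> C)" for v
    proof -
      have "component E (S - (R \<union> C)) v \<subseteq> component E (S - C) v"
        by (rule component_mono) auto
      then have "card (E `` (R \<union> C) \<inter> component E (S - (R \<union> C)) v)
          \<le> card ((component E (S - C) v \<inter> E `` R) \<union> E `` C)"
        using W NC by (intro card_mono) auto
      also have "\<dots> \<le> card (component E (S - C) v \<inter> E `` R) + card (E `` C)"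
        by (rule card_Un_le)
      also have "card (E `` C) \<le> q * D"
        using order_trans[OF NC(2) mult_le_mono2[OF C(3)]] by (simp add: mult.commute)
      also have "card (component E (S - C) v \<inter> E `` R) \<le> q * D"
      proof -
        let ?n = "card (component E (S - C) v \<inter> E `` R)"
        have "2 * (D * ?n) \<le> 2 ^ Suc D * ?n"
          using less_exp[of D] by (simp add: less_imp_le)
        also have "\<dots> \<le> card (E `` R)" using C(4)[of v] v by blast
        also note W(2)
        also have "D * card R \<le> D * K" using SR(4) by (rule mult_le_mono2)
        finally show ?thesis using D_pos by (simp add: K_def)
      qed
      finally show ?thesis by (simp add: K_def)
    qed
    moreover have "card (R \<union> C) \<le> K + q"
      using card_Un_le[of R C] SR(4) C(3) by simp
    ultimately show ?thesis
      using SR(2,3) C(1,2) by (intro exI[of _ "R \<union> C"]) simp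
  qed
  moreover have "0 < K" using separable_pos[OF sep] D_pos by (simp add: K_def q_def)
  ultimately show ?thesis using that[of K "K + q"] by blast
qed

section \<open>A tree partition\<close>

text \<open>Cut the walk after its last visit to \<open>X\<close>. The rest stays in
  \<open>S - X\<close> and is strictly shorter, which makes the recursion reach every vertex after
  finitely many steps.\<close>

lemma relpow_last_exit:
  assumes "(x, v) \<in> (E \<inter> S \<times> S) ^^ d" "x \<in> X" "v \<in> S - X"
  shows "\<exists>y \<in> E `` X \<inter> (S - X). \<exists>d'<d. (y, v) \<in> (E \<inter> (S - X) \<times> (S - X)) ^^ d'"
  using assms
proof (induction d arbitrary: v)
  case 0
  then show ?case by simp
next
  case (Suc d)
  then obtain z where z: "(x, z) \<in> (E \<inter> S \<times> S) ^^ d" "(z, v) \<in> E" "z \<in> S"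
    by auto
  show ?case
  proof (cases "z \<in> X")
    case True
    then show ?thesis
      using z Suc.prems by (intro bexI[of _ v] exI[of _ 0]) auto
  next
    case False
    then obtain y d' where "y \<in> E `` X \<inter> (S - X)" "d' < d"
      "(y, z) \<in> (E \<inter> (S - X) \<times> (S - X)) ^^ d'"
      using Suc.IH[OF z(1) Suc.prems(2), of] z(3) by blast
    then show ?thesis
      using z False Suc.prems by (intro bexI[of _ y] exI[of _ "Suc d'"]) auto
  qed
qed

lemma relpow_component:
  assumes "(y, v) \<in> (E \<inter> S \<times> S) ^^ d"
  shows "(y, v) \<in> (E \<inter> component E S y \<times> component E S y) ^^ d \<and> v \<in> component E S y"
  using assms
proof (induction d arbitrary: v)
  case (Suc d)
  then obtain z where z: "(y, z) \<in> (E \<inter> S \<times> S) ^^ d" "(z, v) \<in> E" "z \<in> S" "v \<in> S"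
    by auto
  then have "v \<in> component E S y"
    using Suc.IH[OF z(1)] by (auto intro: component_closed)
  then show ?case using Suc.IH[OF z(1)] z(2) by auto
qed simp

text \<open>
  The address of a vertex records the components containing it that the recursion enters until the
  vertex is in a bag, the last one first; \<open>M\<close> bounds the branching and \<open>L\<close> the size of the bags.
\<close>

lemma address_map:
  assumes sep: "separable E V B" and D_pos: "0 < D"
    and degree: "\<forall>x\<in>V. finite (E `` {x}) \<and> card (E `` {x}) \<le> D"
    and EV: "E \<subseteq> V \<times> V" and root: "r \<in> V" and conn: "\<forall>v\<in>V. (r, v) \<in> E\<^sup>*"
  shows "\<exists>(a :: 'a \<Rightarrow> nat list) M L.
    (\<forall>u v. (u, v) \<in> E \<longrightarrow> a u = a v \<or> (\<exists>c<M. a u = c # a v) \<or> (\<exists>c<M. a v = c # a u)) \<and>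
    (\<forall>l. finite {v \<in> V. a v = l} \<and> card {v \<in> V. a v = l} \<le> L)"
proof -
  obtain K L where "0 < K" and bag_ex: "\<And>S R. \<lbrakk>S \<subseteq> V; R \<subseteq> S; finite R; card R \<le> K\<rbrakk> \<Longrightarrow>
       \<exists>X. R \<subseteq> X \<and> X \<subseteq> S \<and> finite X \<and> card X \<le> L \<and>
         (\<forall>v\<in>S - X. card (E `` X \<inter> component E (S - X) v) \<le> K)"
    by (rule bag_exists[OF sep D_pos degree]) (rule that; blast)
  \<comment> \<open>A state is a pair: the current set, and the boundary vertices in it that its bag
    must contain.\<close>
  define ok where "ok s \<longleftrightarrow> fst s \<subseteq> V \<and> snd s \<subseteq> fst s \<and> finite (snd s) \<and> card (snd s) \<le> K"
    for s :: "'a set \<times> 'a set"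
  have "\<exists>X. snd s \<subseteq> X \<and> X \<subseteq> fst s \<and> finite X \<and> card X \<le> L \<and>
      (\<forall>v\<in>fst s - X. card (E `` X \<inter> component E (fst s - X) v) \<le> K)" if "ok s" for s
    using bag_ex[of "fst s" "snd s"] that by (simp add: ok_def)
  then obtain bag where bag: "\<And>s. ok s \<Longrightarrow> snd s \<subseteq> bag s \<and> bag s \<subseteq> fst s \<and> finite (bag s) \<and>
      card (bag s) \<le> L \<and> (\<forall>v\<in>fst s - bag s. card (E `` bag s \<inter> component E (fst s - bag s) v) \<le> K)"
    by metis
  define child where "child s v = component E (fst s - bag s) v" for s v
  define next_state where "next_state v s = (child s v, E `` bag s \<inter> child s v)" for s v
  \<comment> \<open>Each child contains a neighbour of the bag, so there are at most
    \<open>D * L\<close> children.\<close>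
  define children where "children s = child s ` (E `` bag s \<inter> (fst s - bag s))" for s
  have boundary: "finite (E `` bag s)" "card (E `` bag s) \<le> D * L" if "ok s" for s
  proof -
    have *: "\<And>x. x \<in> bag s \<Longrightarrow> finite (E `` {x}) \<and> card (E `` {x}) \<le> D"
      using bag[OF that] that degree by (auto simp: ok_def)
    have "finite (bag s)" "card (bag s) \<le> L" using bag[OF that] by auto
    with card_Image_le[OF this(1) *] show "finite (E `` bag s)" "card (E `` bag s) \<le> D * L"
      by (auto intro: order_trans mult_le_mono2)
  qed
  have "\<exists>h. inj_on h (children s) \<and> h ` children s \<subseteq> {..<D * L}" if "ok s" for s
  proof -
    have fin: "finite (children s)" using boundary[OF that] by (simp add: children_def)
    have "card (children s) \<le> card (E `` bag s \<inter> (fst s - bag s))"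
      unfolding children_def using boundary[OF that] by (intro card_image_le) simp
    also have "\<dots> \<le> card (E `` bag s)"
      using boundary[OF that] by (intro card_mono) auto
    also have "\<dots> \<le> D * L" by (rule boundary[OF that])
    finally have "card (children s) \<le> card {..<D * L}" by simp
    then show ?thesis using card_le_inj[OF fin, of "{..<D * L}"] by blast
  qed
  then obtain idx where idx: "\<And>s. ok s \<Longrightarrow> inj_on (idx s) (children s) \<and> idx s ` children s \<subseteq> {..<D * L}"
    by metis
  \<comment> \<open>The iteration also runs past the bag of \<open>v\<close>; only the states up to
    \<open>dep v\<close> are meaningful.\<close>
  define st where "st v n = (next_state v ^^ n) (V, {r})" for v n
  have st_0: "st v 0 = (V, {r})" and st_Suc: "st v (Suc n) = next_state v (st v n)" for v n
    by (simp_all add: st_def)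
  \<comment> \<open>\<open>d\<close> is the length of a walk from the boundary to \<open>v\<close>
    inside the current set. It is the measure that decreases.\<close>
  define reach where "reach s v d \<longleftrightarrow> (\<exists>x\<in>snd s. (x, v) \<in> (E \<inter> fst s \<times> fst s) ^^ d)" for s v d
  define good where "good s v \<longleftrightarrow> ok s \<and> v \<in> fst s" for s v
  have step: "good (next_state v s) v \<and> child s v \<in> children s \<and> (\<exists>d'<d. reach (next_state v s) v d')"
    if s: "good s v" "v \<notin> bag s" "reach s v d" for s v d
  proof -
    have v: "v \<in> fst s - bag s" and "ok s" using s by (auto simp: good_def)
    note b = bag[OF \<open>ok s\<close>]
    obtain x where "x \<in> bag s" "(x, v) \<in> (E \<inter> fst s \<times> fst s) ^^ d"
      using s(3) b unfolding reach_def by blast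
    then obtain y d' where y: "y \<in> E `` bag s \<inter> (fst s - bag s)" "d' < d"
      "(y, v) \<in> (E \<inter> (fst s - bag s) \<times> (fst s - bag s)) ^^ d'"
      using relpow_last_exit[where S = "fst s" and X = "bag s"] v by blast
    note yv = relpow_component[OF y(3)]
    have eq: "child s v = child s y"
      unfolding child_def using yv component_eq[OF separable_sym[OF sep]] by blast
    have "y \<in> snd (next_state v s)"
      using y(1) by (simp add: next_state_def eq) (simp add: child_def)
    then have "reach (next_state v s) v d'"
      unfolding reach_def by (rule bexI[rotated]) (use yv eq in \<open>simp add: next_state_def child_def\<close>)
    moreover have "child s v \<in> children s"
      unfolding eq children_def using y(1) by (rule imageI)
    moreover have "child s v \<subseteq> fst s"
      unfolding child_def using component_subset[OF v] by blast
    then have "good (next_state v s) v"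
      using \<open>ok s\<close> boundary[OF \<open>ok s\<close>] b v by (auto simp: good_def ok_def next_state_def child_def)
    ultimately show ?thesis using y(2) by blast
  qed
  \<comment> \<open>Connectedness gives the initial walk, and \<open>0 < K\<close> admits the
    one-element boundary \<open>{r}\<close>.\<close>
  have start: "good (st v 0) v \<and> (\<exists>d. reach (st v 0) v d)" if "v \<in> V" for v
  proof -
    have "E \<inter> V \<times> V = E" using EV by auto
    then show ?thesis
      using conn[rule_format, OF that] that root \<open>0 < K\<close>
      by (auto simp: st_0 good_def ok_def reach_def dest: rtrancl_imp_relpow)
  qed
  have placed: "\<exists>m. v \<in> bag (st v m)" if v: "v \<in> V" for v
  proof -
    have "\<exists>m. v \<in> bag (st v m)" if "good (st v n) v" "reach (st v n) v d" for n d
      using that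
    proof (induction d arbitrary: n rule: less_induct)
      case (less d)
      show ?case
      proof (cases "v \<in> bag (st v n)")
        case False
        then obtain d' where "d' < d" "good (st v (Suc n)) v" "reach (st v (Suc n)) v d'"
          using step[OF less.prems(1) _ less.prems(2)] by (auto simp: st_Suc)
        then show ?thesis using less.IH by blast
      qed blast
    qed
    then show ?thesis using start[OF v] by blast
  qed
  define dep where "dep v = (LEAST m. v \<in> bag (st v m))" for v
  have dep: "v \<in> bag (st v (dep v))" if "v \<in> V" for v
    unfolding dep_def using placed[OF that] by (rule LeastI_ex)
  have dep_less: "v \<notin> bag (st v n)" if "n < dep v" for v n
    using not_less_Least that unfolding dep_def by blast
  have inv: "good (st v n) v \<and> (\<exists>d. reach (st v n) v d)" if "v \<in> V" "n \<le> dep v" for v n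
    using that(2)
  proof (induction n)
    case 0
    show ?case by (rule start[OF that(1)])
  next
    case (Suc n)
    then obtain d where "good (st v n) v" "reach (st v n) v d" by auto
    then show ?case
      using step[of "st v n" v d] dep_less[of n v] Suc.prems by (auto simp: st_Suc)
  qed
  have in_children: "child (st v n) v \<in> children (st v n)" if vn: "v \<in> V" "n < dep v" for v n
  proof -
    obtain d where "good (st v n) v" "reach (st v n) v d" using inv[OF vn(1), of n] vn(2) by auto
    then show ?thesis using step[OF _ dep_less[OF vn(2)]] by blast
  qed
  have okst: "ok (st v n)" if "v \<in> V" "n \<le> dep v" for v n
    using inv[OF that] by (simp add: good_def)
  \<comment> \<open>The newest index goes in front, so that passing to a child is a single
    cons.\<close>
  define addr where "addr v n = rec_nat [] (\<lambda>n l. idx (st v n) (child (st v n) v) # l) n" for v n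
  have addr_0: "addr v 0 = []"
    and addr_Suc: "addr v (Suc n) = idx (st v n) (child (st v n) v) # addr v n" for v n
    by (simp_all add: addr_def)
  have len: "length (addr v n) = n" for v n
    by (induction n) (simp_all add: addr_0 addr_Suc)
  \<comment> \<open>An index determines the child because \<open>idx s\<close> is injective on
    \<open>children s\<close>. So vertices with equal addresses end in the same bag, which bounds
    the fibres.\<close>
  have same: "st u n = st v n" if "u \<in> V" "v \<in> V" "n \<le> dep u" "n \<le> dep v" "addr u n = addr v n" for u v n
    using that(3-5)
  proof (induction n)
    case (Suc n)
    then have eq: "st u n = st v n" by (simp add: addr_Suc)
    have "idx (st v n) (child (st v n) u) = idx (st v n) (child (st v n) v)"
      using Suc.prems eq by (simp add: addr_Suc)
    moreover have "child (st v n) u \<in> children (st v n)" "child (st v n) v \<in> children (st v n)"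
      using in_children[OF that(1), of n] in_children[OF that(2), of n] Suc.prems eq by auto
    ultimately have "child (st v n) u = child (st v n) v"
      using idx[OF okst[OF that(2)], of n] Suc.prems by (auto dest: inj_onD)
    then show ?case by (simp add: st_Suc next_state_def eq)
  qed (simp add: st_0)
  define a where "a v = addr v (dep v)" for v
  have fibre: "finite {v \<in> V. a v = l} \<and> card {v \<in> V. a v = l} \<le> L" for l
  proof (cases "{v \<in> V. a v = l} = {}")
    case True
    show ?thesis unfolding True by simp
  next
    case False
    then obtain u where u: "u \<in> V" "a u = l" by blast
    have "{v \<in> V. a v = l} \<subseteq> bag (st u (dep u))"
    proof
      fix v assume "v \<in> {v \<in> V. a v = l}"
      then have v: "v \<in> V" "a v = a u" using u by auto
      then have "dep v = dep u" using len by (metis a_def)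
      then have "st v (dep v) = st u (dep u)"
        using same[OF v(1) u(1), of "dep u"] v(2) by (simp add: a_def)
      then show "v \<in> bag (st u (dep u))" using dep[OF v(1)] by simp
    qed
    moreover have "finite (bag (st u (dep u)))" "card (bag (st u (dep u))) \<le> L"
      using bag[OF okst[OF u(1)], of "dep u"] by auto
    ultimately show ?thesis by (meson card_mono finite_subset order_trans)
  qed
  \<comment> \<open>Before step \<open>dep u\<close> neither end is in a bag, so the edge keeps both
    in the same component. Then \<open>v\<close> is either in the bag of \<open>u\<close> or a
    boundary vertex of the next state, hence in the next bag.\<close>
  have edge: "a u = a v \<or> (\<exists>c<D * L. a v = c # a u)" if uv: "(u, v) \<in> E" and le: "dep u \<le> dep v" for u v
  proof -
    have V: "u \<in> V" "v \<in> V" using uv EV by auto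
    have eq: "st u n = st v n \<and> addr u n = addr v n" if "n \<le> dep u" for n
      using that
    proof (induction n)
      case (Suc n)
      have "u \<in> fst (st v n) - bag (st v n)" "v \<in> fst (st v n) - bag (st v n)"
        using inv[OF V(1), of n] inv[OF V(2), of n] dep_less[of n u] dep_less[of n v] Suc le
        by (auto simp: good_def)
      then have "v \<in> child (st v n) u"
        unfolding child_def using uv by (intro component_closed[OF component_refl])
      then have "child (st v n) v = child (st v n) u"
        unfolding child_def using component_eq[OF separable_sym[OF sep]] by blast
      then show ?case using Suc by (simp add: st_Suc addr_Suc next_state_def)
    qed (simp add: st_0 addr_0)
    define n where "n = dep u"
    show ?thesis
    proof (cases "dep v = n")
      case True
      then show ?thesis using eq[of n] by (simp add: a_def n_def)
    next
      case False
      then have less: "n < dep v" using le by (simp add: n_def)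
      have "u \<in> bag (st v n)" using dep[OF V(1)] eq[of n] by (simp add: n_def)
      then have "v \<in> snd (st v (Suc n))"
        using uv by (auto simp: st_Suc next_state_def child_def)
      then have "v \<in> bag (st v (Suc n))"
        using bag[OF okst[OF V(2), of "Suc n"]] less by auto
      then have "dep v = Suc n"
        using dep_less[of "Suc n" v] less by (metis Suc_leI le_neq_implies_less)
      then have "a v = idx (st v n) (child (st v n) v) # a u"
        using eq[of n] by (simp add: a_def addr_Suc n_def)
      moreover have "idx (st v n) (child (st v n) v) < D * L"
        using idx[OF okst[OF V(2), of n]] in_children[OF V(2) less] less by auto
      ultimately show ?thesis by blast
    qed
  qed
  have "a u = a v \<or> (\<exists>c<D * L. a u = c # a v) \<or> (\<exists>c<D * L. a v = c # a u)" if "(u, v) \<in> E" for u v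
  proof (cases "dep u \<le> dep v")
    case True
    then show ?thesis using edge that by blast
  next
    case False
    moreover have "(v, u) \<in> E" using that separable_sym[OF sep] by (auto dest: symD)
    ultimately have "a v = a u \<or> (\<exists>c<D * L. a u = c # a v)" by (intro edge) auto
    then show ?thesis by auto
  qed
  then show ?thesis using fibre by (intro exI[of _ a] exI[of _ "D * L"] exI[of _ L]) blast
qed

section \<open>Graph distances and separation\<close>

text \<open>Symmetry of the arcs makes strong components the classes of \<open>component\<close>.
  Reachability in the induced subgraph demands that its endpoints lie in \<open>S\<close>, whereas
  \<open>rtrancl\<close> is reflexive everywhere; hence the extra condition in the fact
  \<open>reach\<close>.\<close>

lemma component_in_sccs_verts:
  assumes sym: "sym (parcs G)" and x: "x \<in> S"
  shows "component (parcs G) S x \<in> pre_digraph.sccs_verts (with_proj G \<restriction> S)"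
proof -
  let ?r = "parcs G \<inter> S \<times> S"
  have ends: "arcs_ends (with_proj G \<restriction> S) = ?r"
    by (auto simp: arcs_ends_conv induce_subgraph_def image_iff)
  have reach: "u \<rightarrow>\<^sup>*\<^bsub>with_proj G \<restriction> S\<^esub> v \<longleftrightarrow> u \<in> S \<and> (u, v) \<in> ?r\<^sup>*" for u v
  proof
    assume "u \<rightarrow>\<^sup>*\<^bsub>with_proj G \<restriction> S\<^esub> v"
    then have uv: "(u, v) \<in> rtrancl_on S ?r" by (simp add: reachable_def ends)
    show "u \<in> S \<and> (u, v) \<in> ?r\<^sup>*"
      using in_rtrancl_on_in_F(1)[OF uv] rtrancl_on_rtranclI[OF uv] by (rule conjI)
  next
    assume uv: "u \<in> S \<and> (u, v) \<in> ?r\<^sup>*"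
    then have "(u, v) \<in> ?r\<^sup>*" by simp
    then have "(u, v) \<in> rtrancl_on S ?r"
    proof (induction rule: rtrancl_induct)
      case base
      show ?case using uv by (blast intro: rtrancl_on_refl)
    next
      case (step y z)
      then show ?case by (blast intro: rtrancl_on_into_rtrancl_on[OF step.IH])
    qed
    then show "u \<rightarrow>\<^sup>*\<^bsub>with_proj G \<restriction> S\<^esub> v" by (simp add: reachable_def ends)
  qed
  let ?K = "component (parcs G) S x"
  have K: "?K \<subseteq> S" using x by (rule component_subset)
  have comp: "component (parcs G) S u = ?K" if "u \<in> ?K" for u
    using component_eq[OF sym that] .
  have iff: "u \<rightarrow>\<^sup>*\<^bsub>with_proj G \<restriction> S\<^esub> v \<longleftrightarrow> v \<in> ?K" if "u \<in> ?K" for u v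
  proof -
    have "v \<in> ?K \<longleftrightarrow> (u, v) \<in> ?r\<^sup>*" unfolding comp[OF that, symmetric] by (simp add: component_def)
    then show ?thesis unfolding reach using K that by blast
  qed
  show ?thesis
    unfolding pre_digraph.sccs_verts_def mem_Collect_eq
  proof (intro conjI ballI allI impI)
    show "?K \<noteq> {}" using component_refl[of x "parcs G" S] by blast
  qed (simp_all add: iff)
qed

text \<open>On \<open>nat\<close>, a supremum is an upper bound only for a bounded family. Here
  \<open>card S\<close> bounds all sizes.\<close>

lemma card_component_le_largest:
  assumes "sym (parcs G)" "finite S" "x \<in> S"
  shows "card (component (parcs G) S x) \<le> largest_component G S"
proof -
  have "K \<subseteq> S" if "K \<in> pre_digraph.sccs_verts (with_proj G \<restriction> S)" for K
  proof
    fix u assume "u \<in> K"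
    then have "u \<rightarrow>\<^sup>*\<^bsub>with_proj G \<restriction> S\<^esub> u"
      using that by (simp add: pre_digraph.sccs_verts_def)
    then show "u \<in> S"
      using in_rtrancl_on_in_F(1)[of u u S] by (simp add: reachable_def)
  qed
  then have "bdd_above (card ` pre_digraph.sccs_verts (with_proj G \<restriction> S))"
    using assms(2) by (intro bdd_aboveI2[of _ _ "card S"] card_mono) auto
  then show ?thesis
    unfolding largest_component_def
    using component_in_sccs_verts[OF assms(1,3)] by (intro cSup_upper) auto
qed

text \<open>Deleting all of \<open>S\<close> is a candidate, so the minimum in \<open>cut\<close> is
  attained.\<close>

lemma cut_separator:
  assumes "sym (parcs G)" "finite S" "S \<noteq> {}"
  shows "\<exists>C\<subseteq>S. card C = cut G S \<and> (\<forall>x\<in>S - C. 2 * card (component (parcs G) (S - C) x) < card S)"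
proof -
  let ?P = "\<lambda>k. \<exists>C\<subseteq>S. card C = k \<and> real (largest_component G (S - C)) < real (card S) / 2"
  have "\<not> u \<rightarrow>\<^sup>*\<^bsub>with_proj G \<restriction> {}\<^esub> v" for u v
    by (auto elim: reachable_in_vertsE)
  then have "pre_digraph.sccs_verts (with_proj G \<restriction> {}) = {}"
    unfolding pre_digraph.sccs_verts_def by blast
  then have "largest_component G (S - S) = 0"
    by (simp add: largest_component_def)
  then have "?P (card S)"
    using assms by (intro exI[of _ S]) (simp add: card_gt_0_iff)
  then have "?P (cut G S)" unfolding cut_def by (rule LeastI)
  then obtain C where C: "C \<subseteq> S" "card C = cut G S"
    "real (largest_component G (S - C)) < real (card S) / 2" by blast
  have "2 * card (component (parcs G) (S - C) x) < card S" if "x \<in> S - C" for x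
    using card_component_le_largest[OF assms(1), of "S - C" x] assms(2) that C(3) by simp
  then show ?thesis using C(1,2) by blast
qed

lemma cut_le_sep:
  assumes "finite S" "S \<noteq> {}" "S \<subseteq> pverts G"
  shows "cut G S \<le> sep G (card S)"
  unfolding sep_def
proof (rule cSup_upper)
  have "cut G S' \<le> card S" if "finite S'" "card S' = card S" for S'
    using cut_le_card[OF that(1), of G] that assms(1,2) by fastforce
  then show "bdd_above {cut G S' | S'. S' \<subseteq> pverts G \<and> finite S' \<and> card S' = card S}"
    by (intro bdd_aboveI[of _ "card S"]) blast
qed (use assms in blast)

lemma separable_graph:
  assumes "pair_bidirected_digraph G" "bounded_degree G" "finite_separation G"
  obtains B D where "separable (parcs G) (pverts G) B" "0 < D"
    "\<forall>x\<in>pverts G. finite (parcs G `` {x}) \<and> card (parcs G `` {x}) \<le> D"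
proof -
  interpret pair_bidirected_digraph G by fact
  have sym: "sym (parcs G)" using arcs_symmetric by (auto intro: symI)
  obtain B where B: "\<And>n. 1 \<le> n \<Longrightarrow> sep G n \<le> B"
    using assms(3) by (auto simp: finite_separation_def)
  obtain D where D: "\<And>v. v \<in> pverts G \<Longrightarrow> finite (out_arcs G v) \<and> out_degree G v \<le> D"
    using assms(2) by (auto simp: bounded_degree_def)
  \<comment> \<open>The successor supplies the positivity required by
    \<open>separable\<close>.\<close>
  have "separable (parcs G) (pverts G) (Suc B)"
    unfolding separable_def
  proof (intro conjI allI impI)
    show "sym (parcs G)" by (rule sym)
    fix S assume S: "S \<subseteq> pverts G" "finite S" "S \<noteq> {}"
    then have "cut G S \<le> Suc B"
      using cut_le_sep[of S G] B[of "card S"] by (simp add: Suc_le_eq card_gt_0_iff)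
    then show "\<exists>C\<subseteq>S. card C \<le> Suc B \<and> (\<forall>x\<in>S - C. 2 * card (component (parcs G) (S - C) x) < card S)"
      using cut_separator[OF sym S(2,3)] by metis
  qed simp
  moreover have "finite (parcs G `` {x}) \<and> card (parcs G `` {x}) \<le> Suc D" if "x \<in> pverts G" for x
  proof -
    have "parcs G `` {x} = snd ` out_arcs G x"
      by (force simp: out_arcs_def)
    then show ?thesis
      using D[OF that] card_image_le[of "out_arcs G x" snd] by (auto simp: out_degree_def)
  qed
  ultimately show ?thesis using that[of "Suc B" "Suc D"] by simp
qed

section \<open>Distances in a connected graph\<close>

lemma connected_rtrancl:
  assumes "pair_bidirected_digraph G" "Digraph_Component.connected G" "u \<in> pverts G" "v \<in> pverts G"
  shows "(u, v) \<in> (parcs G)\<^sup>*"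
proof -
  obtain p where "pre_digraph.awalk G u p v"
    using graph_dist_eq[OF assms] by blast
  interpret pair_bidirected_digraph G by fact
  have "u \<rightarrow>\<^sup>*\<^bsub>G\<^esub> v" using \<open>awalk u p v\<close> reachable_awalk by blast
  then have "(u, v) \<in> rtrancl_on (pverts G) (parcs G)" by (simp add: reachable_def)
  then show ?thesis by (rule rtrancl_on_rtranclI)
qed

lemma graph_dist_arc:
  assumes "pair_bidirected_digraph G" "Digraph_Component.connected G" "(u, v) \<in> parcs G"
  shows "graph_dist G u v \<le> 1"
proof -
  interpret pair_bidirected_digraph G by fact
  have uv: "u \<in> pverts G" "v \<in> pverts G"
    using assms(3) in_arcsD1 in_arcsD2 by auto
  obtain p where p: "awalk u p v" "graph_dist G u v = real (length p)"
    "\<And>q. awalk u q v \<Longrightarrow> length p \<le> length q"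
    using graph_dist_eq[OF assms(1,2) uv] by blast
  have "awalk u [(u, v)] v" using assms(3) uv by (simp add: awalk_simps)
  then have "length p \<le> length [(u, v)]" by (rule p(3))
  then show ?thesis using p(2) by simp
qed

lemma graph_dist_less_1:
  assumes "pair_bidirected_digraph G" "Digraph_Component.connected G" "u \<in> pverts G" "v \<in> pverts G"
    "graph_dist G u v < 1"
  shows "u = v"
proof -
  obtain p where p: "pre_digraph.awalk G u p v" "graph_dist G u v = real (length p)"
    using graph_dist_eq[OF assms(1-4)] by blast
  interpret pair_bidirected_digraph G by fact
  show ?thesis using p assms(5) by (simp add: awalk_Nil_iff)
qed

text \<open>The triangle inequality along a walk, by induction, then applied to a geodesic.\<close>

lemma lipschitz_graph_dist:
  assumes G: "pair_bidirected_digraph G" "Digraph_Component.connected G"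
    and metric: "Metric_space Y d" and g: "g \<in> pverts G \<rightarrow> Y"
    and arc: "\<And>u v. (u, v) \<in> parcs G \<Longrightarrow> d (g u) (g v) \<le> M"
    and uv: "u \<in> pverts G" "v \<in> pverts G"
  shows "d (g u) (g v) \<le> M * graph_dist G u v"
proof -
  interpret Metric_space Y d by fact
  interpret pair_bidirected_digraph G by fact
  have "d (g u) (g v) \<le> M * real (length p)" if "awalk u p v" for p
    using that
  proof (induction p arbitrary: u)
    case Nil
    then have "u = v" "g v \<in> Y" using g by (auto simp: awalk_Nil_iff)
    then show ?case using zero[of "g v" "g v"] by simp
  next
    case (Cons e p)
    then have e: "e \<in> parcs G" "u = fst e" "awalk (snd e) p v" by (auto simp: awalk_Cons_iff)
    then have V: "u \<in> pverts G" "snd e \<in> pverts G" "v \<in> pverts G"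
      using arc_fst_in_verts arc_snd_in_verts awalk_last_in_verts by auto
    have "d (g u) (g v) \<le> d (g u) (g (snd e)) + d (g (snd e)) (g v)"
      using V g by (intro triangle) auto
    also have "\<dots> \<le> M + M * real (length p)"
      using arc[of u "snd e"] e Cons.IH[OF e(3)] by (intro add_mono) auto
    finally show ?case by (simp add: algebra_simps)
  qed
  moreover obtain p where "awalk u p v" "graph_dist G u v = real (length p)"
    using graph_dist_eq[OF G uv] by blast
  ultimately show ?thesis by simp
qed

section \<open>Mapping into the 3-regular tree\<close>

text \<open>A prefix code: \<open>c\<close> becomes a block of \<open>True\<close> closed by
  \<open>False\<close>. Words grow at the front, so a new first index leads to a descendant
  \<open>c + 1\<close> levels down in the binary tree, and bounded indices mean bounded
  jumps.\<close>

definition unary_code :: "nat list \<Rightarrow> bool list" where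
  "unary_code l = concat (map (\<lambda>c. replicate c True @ [False]) l)"

lemma unary_code_Cons: "unary_code (c # l) = (replicate c True @ [False]) @ unary_code l"
  by (simp add: unary_code_def)

text \<open>The first \<open>False\<close> marks the end of the first block, so decoding is
  unique.\<close>

lemma inj_unary_code: "inj unary_code"
proof (rule injI)
  have unary: "c = c' \<and> x = y"
    if "replicate c True @ False # x = replicate c' True @ False # y" for c c' and x y :: "bool list"
    using that
  proof (induction c arbitrary: c')
    case 0
    then show ?case by (cases c') auto
  next
    case (Suc c)
    then show ?case by (cases c') auto
  qed
  fix l l' assume "unary_code l = unary_code l'"
  then show "l = l'"
  proof (induction l arbitrary: l')
    case Nil
    then show ?case by (cases l') (auto simp: unary_code_def)
  next
    case (Cons c l)
    then obtain c' k where l': "l' = c' # k" by (cases l') (auto simp: unary_code_def)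
    then show ?case using Cons unary[of c "unary_code l" c' "unary_code k"]
      by (auto simp: unary_code_Cons)
  qed
qed

text \<open>Words describe paths from the root read from the back, so \<open>s\<close> is the lowest
  common ancestor of \<open>w\<close> and \<open>w'\<close>, where their branches diverge.\<close>

lemma longest_common_suffix_split:
  obtains p q s where "w = p @ s" "w' = q @ s" "p = [] \<or> q = [] \<or> last p \<noteq> last q"
proof -
  have "\<exists>p q s. w = p @ s \<and> w' = q @ s \<and> (p = [] \<or> q = [] \<or> last p \<noteq> last q)"
  proof (induction w arbitrary: w' rule: rev_induct)
    case (snoc a w)
    show ?case
    proof (cases "w' = [] \<or> last w' \<noteq> a")
      case True
      then show ?thesis by (intro exI[of _ "w @ [a]"] exI[of _ w'] exI[of _ "[]"]) auto
    next
      case False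
      then have w': "w' = butlast w' @ [a]" by auto
      obtain p q s where "w = p @ s" "butlast w' = q @ s" "p = [] \<or> q = [] \<or> last p \<noteq> last q"
        using snoc.IH[of "butlast w'"] by blast
      then show ?thesis
        using w' by (intro exI[of _ p] exI[of _ q] exI[of _ "s @ [a]"]) (metis append_assoc)
    qed
  qed simp
  then show ?thesis using that by blast
qed

section \<open>Reduced walks and a binary subtree\<close>

text \<open>A shortest closed stretch of the walk cannot have length one, as there are no loops, nor
  two, as there is no backtracking. With length at least three it would be a cycle.\<close>

lemma reduced_walk_inj:
  assumes T: "undirected_tree T"
    and arc: "\<And>i. i < n \<Longrightarrow> (x i, x (Suc i)) \<in> parcs T"
    and reduced: "\<And>i. Suc (Suc i) \<le> n \<Longrightarrow> x i \<noteq> x (Suc (Suc i))"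
    and ij: "i < j" "j \<le> n"
  shows "x i \<noteq> x j"
proof
  assume eq: "x i = x j"
  interpret pair_bidirected_digraph T using T by (simp add: undirected_tree_def)
  define Q where "Q d \<longleftrightarrow> 0 < d \<and> (\<exists>i. i + d \<le> n \<and> x i = x (i + d))" for d
  have "Q (j - i)" using eq ij by (auto simp: Q_def intro!: exI[of _ i])
  define d where "d = (LEAST d. Q d)"
  have "Q d" unfolding d_def by (rule LeastI) fact
  have min: "\<not> Q e" if "e < d" for e using not_less_Least that unfolding d_def by blast
  obtain i where i: "0 < d" "i + d \<le> n" "x i = x (i + d)" using \<open>Q d\<close> by (auto simp: Q_def)
  have "d \<noteq> 1" using i arc[of i] pair_no_loops[of "(x i, x (Suc i))"] by auto
  moreover have "d \<noteq> 2" using i reduced[of i] by auto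
  ultimately have d3: "3 \<le> d" using i(1) by simp
  define p where "p = map (\<lambda>k. (x k, x (Suc k))) [i..<i + d]"
  have "awalk (x i) (map (\<lambda>k. (x k, x (Suc k))) [i..<i + e]) (x (i + e))" if "e \<le> d" for e
    using that
  proof (induction e)
    case 0
    have "(x i, x (Suc i)) \<in> parcs T" using arc[of i] i(1,2) by simp
    then show ?case using in_arcsD1 by (simp add: awalk_Nil_iff)
  next
    case (Suc e)
    have "(x (i + e), x (Suc (i + e))) \<in> parcs T" using arc[of "i + e"] i(2) Suc.prems by simp
    then have "awalk (x (i + e)) [(x (i + e), x (Suc (i + e)))] (x (Suc (i + e)))"
      using in_arcsD2 by (simp add: awalk_simps)
    then show ?case using Suc awalk_appendI by simp
  qed
  then have walk: "awalk (x i) p (x i)" using i(3) by (simp add: p_def)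
  have "p \<noteq> []" using i(1) by (simp add: p_def)
  \<comment> \<open>A repetition among these vertices would give a shorter closed stretch.\<close>
  have "inj_on (\<lambda>k. x (Suc k)) {i..<i + d}"
  proof (rule inj_onI)
    have "x (Suc k) \<noteq> x (Suc l)" if "k < l" "i \<le> k" "l < i + d" for k l
    proof
      assume "x (Suc k) = x (Suc l)"
      then have "Q (l - k)" using that i(2) by (auto simp: Q_def intro!: exI[of _ "Suc k"])
      then show False using min[of "l - k"] that by auto
    qed
    then show "k = l" if "k \<in> {i..<i + d}" "l \<in> {i..<i + d}" "x (Suc k) = x (Suc l)" for k l
      using that by (metis atLeastLessThan_iff linorder_neqE_nat)
  qed
  then have "distinct (tl (awalk_verts (x i) p))"
    using walk \<open>p \<noteq> []\<close> awalk_verts_conv'[of "x i" p "x i"]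
    by (simp add: awalk_def p_def distinct_map comp_def)
  then have "pre_digraph.cycle T p"
    unfolding cycle_def using walk \<open>p \<noteq> []\<close> by auto
  moreover have "3 \<le> length p" using d3 by (simp add: p_def)
  ultimately show False using T by (auto simp: undirected_tree_def)
qed

text \<open>Degree three leaves two children after discarding the parent. For injectivity, the walk
  from one word up to the lowest common ancestor and down to the other never backtracks, so its ends
  differ.\<close>

lemma binary_tree_embedding:
  assumes T: "regular_tree 3 T"
  obtains \<psi> :: "bool list \<Rightarrow> 'b" where "inj \<psi>" "range \<psi> \<subseteq> pverts T"
    "\<And>b w. (\<psi> w, \<psi> (b # w)) \<in> parcs T"
proof -
  have tree: "undirected_tree T" and deg: "\<And>v. v \<in> pverts T \<Longrightarrow> finite (out_arcs T v) \<and> out_degree T v = 3"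
    using T by (auto simp: regular_tree_def)
  interpret pair_bidirected_digraph T using tree by (simp add: undirected_tree_def)
  have "strongly_connected (with_proj (mk_symmetric T))"
    using tree by (simp add: undirected_tree_def Digraph_Component.connected_def)
  then obtain t where t: "t \<in> pverts T" by (auto simp: strongly_connected_def mk_symmetric_def)
  have "\<exists>c. c True \<noteq> c False \<and> (\<forall>b. (v, c b) \<in> parcs T \<and> c b \<noteq> p)" if "v \<in> pverts T" for v p
  proof -
    let ?N = "snd ` out_arcs T v"
    have "inj_on snd (out_arcs T v)" by (auto simp: inj_on_def out_arcs_def)
    then have "card ?N = 3" "finite ?N"
      using deg[OF that] by (auto simp: card_image out_degree_def)
    then have "2 \<le> card (?N - {p})" using card_Diff1_le[of ?N p] by (cases "p \<in> ?N") auto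
    then obtain A where "A \<subseteq> ?N - {p}" "card A = 2"
      by (rule obtain_subset_with_card_n)
    then obtain y z where "y \<in> ?N - {p}" "z \<in> ?N - {p}" "y \<noteq> z"
      unfolding card_2_iff by blast
    then show ?thesis by (intro exI[of _ "\<lambda>b. if b then y else z"]) (auto simp: out_arcs_def)
  qed
  then obtain c where c: "\<And>v p. v \<in> pverts T \<Longrightarrow>
      c v p True \<noteq> c v p False \<and> (\<forall>b. (v, c v p b) \<in> parcs T \<and> c v p b \<noteq> p)"
    by metis
  \<comment> \<open>\<open>\<phi>\<close> carries a vertex with its parent. The root is its own
    dummy parent, which excludes none of its neighbours.\<close>
  define \<phi> where "\<phi> = rec_list (t, t) (\<lambda>b _ (v, p). (c v p b, v))"
  define \<psi> where "\<psi> w = fst (\<phi> w)" for w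
  have \<phi>_Nil: "\<phi> [] = (t, t)" and \<phi>_Cons: "\<phi> (b # w) = (c (\<psi> w) (snd (\<phi> w)) b, \<psi> w)" for b w
    by (simp_all add: \<phi>_def \<psi>_def split_beta)
  have \<psi>_Cons: "\<psi> (b # w) = c (\<psi> w) (snd (\<phi> w)) b" for b w by (simp add: \<psi>_def \<phi>_Cons)
  have V: "\<psi> w \<in> pverts T" for w
  proof (induction w)
    case Nil
    show ?case using t by (simp add: \<psi>_def \<phi>_Nil)
  next
    case (Cons b w)
    then have "(\<psi> w, \<psi> (b # w)) \<in> parcs T" using c by (simp add: \<psi>_Cons)
    then show ?case using in_arcsD2 by auto
  qed
  have arc: "(\<psi> w, \<psi> (b # w)) \<in> parcs T" for b w using c[OF V] by (simp add: \<psi>_Cons)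
  have sibling: "\<psi> (b # w) \<noteq> \<psi> (b' # w)" if "b \<noteq> b'" for b b' w
    using c[OF V, of w "snd (\<phi> w)"] that by (cases b; cases b') (auto simp: \<psi>_Cons)
  have grandparent: "\<psi> (b' # b # w) \<noteq> \<psi> w" for b b' w
    using c[OF V, of "b # w" "snd (\<phi> (b # w))"] by (simp add: \<psi>_Cons[of b'] \<phi>_Cons[of b w])
  have "w = w'" if eq: "\<psi> w = \<psi> w'" for w w'
  proof (rule ccontr)
    assume "w \<noteq> w'"
    obtain p q s where w: "w = p @ s" "w' = q @ s" and pq: "p = [] \<or> q = [] \<or> last p \<noteq> last q"
      by (rule longest_common_suffix_split)
    define n where "n = length p + length q"
    \<comment> \<open>Positions up to \<open>length p\<close> climb from \<open>w\<close> to
      \<open>s\<close>, later ones descend to \<open>w'\<close>; both formulas agree at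
      \<open>s\<close>.\<close>
    define x where "x i = (if i \<le> length p then \<psi> (drop i p @ s) else \<psi> (drop (n - i) q @ s))" for i
    have n: "0 < n" using \<open>w \<noteq> w'\<close> w by (auto simp: n_def)
    have x_up: "x i = \<psi> (drop i p @ s)" if "i \<le> length p" for i using that by (simp add: x_def)
    have x_down: "x i = \<psi> (drop (n - i) q @ s)" if "length p \<le> i" for i
      using that by (cases "i = length p") (auto simp: x_def n_def)
    have "x 0 \<noteq> x n"
    proof (rule reduced_walk_inj[OF tree _ _ n])
      fix i assume i: "i < n"
      show "(x i, x (Suc i)) \<in> parcs T"
      proof (cases "i < length p")
        case True
        then have "drop i p = p ! i # drop (Suc i) p" by (simp add: Cons_nth_drop_Suc)
        then have "(x (Suc i), x i) \<in> parcs T" using arc True by (simp add: x_up)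
        then show ?thesis by (rule arcs_symmetric)
      next
        case False
        define j where "j = n - Suc i"
        have j: "j < length q" "n - i = Suc j" using False i by (auto simp: j_def n_def)
        then have "drop j q = q ! j # drop (Suc j) q" by (simp add: Cons_nth_drop_Suc)
        then show ?thesis using arc False j by (simp add: x_down flip: j_def)
      qed
    next
      fix i assume i: "Suc (Suc i) \<le> n"
      \<comment> \<open>Backtracking is excluded by \<open>grandparent\<close> on the way up and
        down, and by the distinct last letters of \<open>p\<close> and \<open>q\<close> at the
        turning point.\<close>
      consider "Suc (Suc i) \<le> length p" | "Suc i = length p" | "length p \<le> i" by linarith
      then show "x i \<noteq> x (Suc (Suc i))"
      proof cases
        case 1
        then have "drop i p = p ! i # p ! Suc i # drop (Suc (Suc i)) p"
          by (simp add: Cons_nth_drop_Suc)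
        then show ?thesis using grandparent 1 by (simp add: x_up)
      next
        case 2
        then have ne: "p \<noteq> []" "q \<noteq> []" using i by (auto simp: n_def)
        have "drop i p = [last p]"
          using 2 ne by (metis append_butlast_last_id append_eq_conv_conj diff_Suc_1 length_butlast)
        moreover have "n - Suc (Suc i) = length q - 1" using 2 by (simp add: n_def)
        moreover have "drop (length q - 1) q = [last q]"
          using ne by (metis append_butlast_last_id append_eq_conv_conj length_butlast)
        ultimately show ?thesis using sibling pq ne 2 by (simp add: x_up x_down)
      next
        case 3
        define j where "j = n - Suc (Suc i)"
        have j: "Suc j < length q" "n - i = Suc (Suc j)" using 3 i by (auto simp: j_def n_def)
        then have "drop j q = q ! j # q ! Suc j # drop (Suc (Suc j)) q"
          by (simp add: Cons_nth_drop_Suc)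
        then show ?thesis using grandparent[symmetric] 3 j by (simp add: x_down flip: j_def)
      qed
    qed simp
    then show False using eq w by (simp add: x_up x_down n_def)
  qed
  then have "inj \<psi>" by (rule injI)
  then show ?thesis using that V arc by blast
qed

theorem theorem2p1:
  fixes G :: "'a pair_pre_digraph" and T :: "'b pair_pre_digraph"
  assumes "pair_bidirected_digraph G"
    and "Digraph_Component.connected G"
    and "bounded_degree G"
    and "finite_separation G"
    and "regular_tree 3 T"
  shows "\<exists>f. regular_map (pverts G) (graph_dist G) (pverts T) (graph_dist T) f"
proof -
  note G = assms(1,2)
  have T: "pair_bidirected_digraph T" "Digraph_Component.connected T"
    using assms(5) by (auto simp: regular_tree_def undirected_tree_def)
  obtain B D where sep: "separable (parcs G) (pverts G) B" and D_pos: "0 < D"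
    and degree: "\<forall>x\<in>pverts G. finite (parcs G `` {x}) \<and> card (parcs G `` {x}) \<le> D"
    by (rule separable_graph[OF assms(1,3,4)])
  interpret G: pair_bidirected_digraph G by fact
  interpret MG: Metric_space "pverts G" "graph_dist G" by (rule Metric_space_graph_dist[OF G])
  interpret MT: Metric_space "pverts T" "graph_dist T" by (rule Metric_space_graph_dist[OF T])
  have "strongly_connected (with_proj (mk_symmetric G))"
    using assms(2) by (simp add: Digraph_Component.connected_def)
  then obtain r where r: "r \<in> pverts G" by (auto simp: strongly_connected_def mk_symmetric_def)
  have arcs: "parcs G \<subseteq> pverts G \<times> pverts G" using G.in_arcsD1 G.in_arcsD2 by auto
  have conn: "\<forall>v\<in>pverts G. (r, v) \<in> (parcs G)\<^sup>*"
    using connected_rtrancl[OF G r] by simp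
  obtain a :: "'a \<Rightarrow> nat list" and M L where
    step: "\<forall>u v. (u, v) \<in> parcs G \<longrightarrow> a u = a v \<or> (\<exists>c<M. a u = c # a v) \<or> (\<exists>c<M. a v = c # a u)"
    and fibre: "\<forall>l. finite {v \<in> pverts G. a v = l} \<and> card {v \<in> pverts G. a v = l} \<le> L"
    using address_map[OF sep D_pos degree arcs r conn] by (elim exE conjE) (rule that)
  obtain \<psi> :: "bool list \<Rightarrow> 'b" where \<psi>: "inj \<psi>" "range \<psi> \<subseteq> pverts T" "\<And>b w. (\<psi> w, \<psi> (b # w)) \<in> parcs T"
    using binary_tree_embedding[OF assms(5)] by blast
  have \<psi>V: "\<psi> w \<in> pverts T" for w using \<psi>(2) by auto
  have dist_refl: "graph_dist T (\<psi> w) (\<psi> w) = 0" for w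
    using MT.zero[OF \<psi>V \<psi>V, of w w] by simp
  have descend: "graph_dist T (\<psi> w) (\<psi> (u @ w)) \<le> real (length u)" for u w
  proof (induction u)
    case (Cons b u)
    have "graph_dist T (\<psi> w) (\<psi> (b # u @ w))
        \<le> graph_dist T (\<psi> w) (\<psi> (u @ w)) + graph_dist T (\<psi> (u @ w)) (\<psi> (b # u @ w))"
      by (intro MT.triangle \<psi>V)
    then show ?case using Cons graph_dist_arc[OF T \<psi>(3)[of "u @ w" b]] by simp
  qed (simp add: dist_refl)
  \<comment> \<open>Two injective maps follow the address map, so the nonempty fibres of
    \<open>f\<close> are fibres of \<open>a\<close>.\<close>
  define f where "f v = \<psi> (unary_code (a v))" for v
  have fV: "f \<in> pverts G \<rightarrow> pverts T" using \<psi>V by (simp add: f_def)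
  have code_step: "graph_dist T (\<psi> (unary_code l)) (\<psi> (unary_code (c # l))) \<le> real M" if "c < M" for c l
    using descend[of "unary_code l" "replicate c True @ [False]"] that by (simp add: unary_code_Cons)
  have arc: "graph_dist T (f u) (f v) \<le> real M" if "(u, v) \<in> parcs G" for u v
    using step[rule_format, OF that]
  proof (elim disjE exE conjE)
    assume "a u = a v"
    then show ?thesis by (simp add: f_def dist_refl)
  next
    fix c assume "c < M" "a u = c # a v"
    then show ?thesis using code_step[of c "a v"] by (simp add: f_def MT.commute)
  next
    fix c assume "c < M" "a v = c # a u"
    then show ?thesis using code_step[of c "a u"] by (simp add: f_def)
  qed
  \<comment> \<open>One constant serves both conditions: \<open>M\<close> bounds the jump along an
    edge, \<open>L\<close> the number of preimages.\<close>
  have "kappa_regular (real M + real L) (pverts G) (graph_dist G) (pverts T) (graph_dist T) f"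
    unfolding kappa_regular_def
  proof (intro conjI ballI)
    show "f \<in> pverts G \<rightarrow> pverts T" by (rule fV)
  next
    fix u v assume uv: "u \<in> pverts G" "v \<in> pverts G"
    have "graph_dist T (f u) (f v) \<le> real M * graph_dist G u v"
      using lipschitz_graph_dist[OF G MT.Metric_space_axioms fV arc uv] by simp
    also have "\<dots> \<le> (real M + real L) * (1 + graph_dist G u v)"
      using MG.nonneg by (intro mult_mono) auto
    finally show "graph_dist T (f u) (f v) \<le> (real M + real L) * (1 + graph_dist G u v)" .
  next
    fix y assume y: "y \<in> pverts T"
    let ?A = "{v \<in> pverts G. f v = y}"
    have A: "finite ?A \<and> card ?A \<le> L"
    proof (cases "?A = {}")
      case True
      show ?thesis unfolding True by simp
    next
      case False
      then obtain u where "f u = y" by blast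
      then have "?A = {v \<in> pverts G. a v = a u}"
        using injD[OF \<psi>(1)] injD[OF inj_unary_code] by (auto simp: f_def)
      then show ?thesis using fibre by simp
    qed
    have "f v = y" if "f v \<in> MT.mball y 1" for v
      using that graph_dist_less_1[OF T, of y "f v"] by simp
    then have "{x \<in> pverts G. f x \<in> MT.mball y 1} \<subseteq> (\<Union>v\<in>?A. MG.mball v 1)"
      by (auto simp: MG.centre_in_mball_iff)
    then show "\<exists>A\<subseteq>pverts G. finite A \<and> real (card A) \<le> real M + real L \<and>
        {x \<in> pverts G. f x \<in> MT.mball y 1} \<subseteq> (\<Union>v\<in>A. MG.mball v 1)"
      using A by (intro exI[of _ ?A]) auto
  qed
  then show ?thesis by (auto simp: regular_map_def)
qed

end
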